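(* Suppose that $H, G$ are discrete groups and $G$ acts on $H$ by automorphisms. The following are equivalent: (i) $H\rtimes G$ is MAP; (ii) $G$ is MAP and the irreducible finite-dimensional representations of $H$ whose orbits in $\widehat H$ are finite separate points of $H$.
   Context: A discrete group is MAP (maximally almost periodic) if its finite-dimensional unitary representations separate its points. Representations of groups are unitary. $\widehat H$ is the set of unitary equivalence classes of irreducible unitary representations of $H$. The action $\alpha$ of $G$ on $H$ induces the action of $G$ on $\widehat H$ given by $(g\cdot\rho)(h)=\rho(\alpha_{g^{-1}}(h))$, and orbits are taken with respect to this action. *)

theory Defs
  imports "HOL-Algebra.Algebra" "Jordan_Normal_Form.Schur_Decomposition"
begin

definition unitary_group :: "nat \<Rightarrow> complex mat monoid" where
  "unitary_group n =
    \<lparr>carrier = {A \<in> carrier_mat n n. mat_adjoint A * A = 1\<^sub>m n \<and> A * mat_adjoint A = 1\<^sub>m n},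
     monoid.mult = (*), one = 1\<^sub>m n\<rparr>"

text \<open>Up to unitary equivalence, a unitary representation of dimension \<open>n\<close> acts on
  \<open>\<complex>\<^sup>n\<close>. Maps are taken extensional, as for \<^const>\<open>Bij\<close>, so that
  representations which agree on the group are equal.\<close>

definition unitary_rep :: "('a, 'm) monoid_scheme \<Rightarrow> nat \<Rightarrow> ('a \<Rightarrow> complex mat) \<Rightarrow> bool" where
  "unitary_rep H n \<rho> \<longleftrightarrow> \<rho> \<in> hom H (unitary_group n) \<and> \<rho> \<in> extensional (carrier H)"

definition fd_reps :: "('a, 'm) monoid_scheme \<Rightarrow> ('a \<Rightarrow> complex mat) set" where
  "fd_reps H = {\<rho>. \<exists>n. unitary_rep H n \<rho>}"

definition invariant_subspace ::
    "('a, 'm) monoid_scheme \<Rightarrow> nat \<Rightarrow> ('a \<Rightarrow> complex mat) \<Rightarrow> complex vec set \<Rightarrow> bool" where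
  "invariant_subspace H n \<rho> W \<longleftrightarrow>
    VectorSpace.subspace class_ring W (module_vec TYPE(complex) n) \<and>
    (\<forall>h \<in> carrier H. \<forall>w \<in> W. \<rho> h *\<^sub>v w \<in> W)"

definition irreducible_rep :: "('a, 'm) monoid_scheme \<Rightarrow> nat \<Rightarrow> ('a \<Rightarrow> complex mat) \<Rightarrow> bool" where
  "irreducible_rep H n \<rho> \<longleftrightarrow>
    unitary_rep H n \<rho> \<and> n > 0 \<and>
    (\<forall>W. invariant_subspace H n \<rho> W \<longrightarrow> W = {0\<^sub>v n} \<or> W = carrier_vec n)"

definition fd_irreps :: "('a, 'm) monoid_scheme \<Rightarrow> ('a \<Rightarrow> complex mat) set" where
  "fd_irreps H = {\<rho>. \<exists>n. irreducible_rep H n \<rho>}"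

definition unitary_equiv ::
    "('a, 'm) monoid_scheme \<Rightarrow> (('a \<Rightarrow> complex mat) \<times> ('a \<Rightarrow> complex mat)) set" where
  "unitary_equiv H =
    {(\<rho>, \<sigma>). \<rho> \<in> fd_irreps H \<and> \<sigma> \<in> fd_irreps H \<and>
      (\<exists>n. unitary_rep H n \<rho> \<and> unitary_rep H n \<sigma> \<and>
        (\<exists>U \<in> carrier (unitary_group n). \<forall>h \<in> carrier H. U * \<rho> h = \<sigma> h * U))}"

text \<open>The finite-dimensional part of the unitary dual. The action preserves dimension, so the
  orbit of a finite-dimensional class in the whole dual lies in this part.\<close>

definition fd_dual :: "('a, 'm) monoid_scheme \<Rightarrow> ('a \<Rightarrow> complex mat) set set" where
  "fd_dual H = fd_irreps H // unitary_equiv H"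

definition rep_action ::
    "('a, 'm) monoid_scheme \<Rightarrow> ('b, 'k) monoid_scheme \<Rightarrow> ('b \<Rightarrow> 'a \<Rightarrow> 'a) \<Rightarrow>
      'b \<Rightarrow> ('a \<Rightarrow> complex mat) \<Rightarrow> ('a \<Rightarrow> complex mat)" where
  "rep_action H G \<alpha> g \<rho> = (\<lambda>h \<in> carrier H. \<rho> (\<alpha> (inv\<^bsub>G\<^esub> g) h))"

definition dual_action ::
    "('a, 'm) monoid_scheme \<Rightarrow> ('b, 'k) monoid_scheme \<Rightarrow> ('b \<Rightarrow> 'a \<Rightarrow> 'a) \<Rightarrow>
      'b \<Rightarrow> ('a \<Rightarrow> complex mat) set \<Rightarrow> ('a \<Rightarrow> complex mat) set" where
  "dual_action H G \<alpha> g = (\<lambda>C \<in> fd_dual H. rep_action H G \<alpha> g ` C)"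

definition finite_orbit_irreps ::
    "('a, 'm) monoid_scheme \<Rightarrow> ('b, 'k) monoid_scheme \<Rightarrow> ('b \<Rightarrow> 'a \<Rightarrow> 'a) \<Rightarrow>
      ('a \<Rightarrow> complex mat) set" where
  "finite_orbit_irreps H G \<alpha> =
    {\<rho> \<in> fd_irreps H. finite (orbit G (dual_action H G \<alpha>) (unitary_equiv H `` {\<rho>}))}"

definition separates_points :: "('a, 'm) monoid_scheme \<Rightarrow> ('a \<Rightarrow> 'c) set \<Rightarrow> bool" where
  "separates_points H R \<longleftrightarrow>
    (\<forall>x \<in> carrier H. \<forall>y \<in> carrier H. x \<noteq> y \<longrightarrow> (\<exists>\<rho> \<in> R. \<rho> x \<noteq> \<rho> y))"

definition MAP :: "('a, 'm) monoid_scheme \<Rightarrow> bool" where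
  "MAP H \<longleftrightarrow> separates_points H (fd_reps H)"

definition semidirect_product ::
    "('a, 'm) monoid_scheme \<Rightarrow> ('b, 'k) monoid_scheme \<Rightarrow> ('b \<Rightarrow> 'a \<Rightarrow> 'a) \<Rightarrow> ('a \<times> 'b) monoid" where
  "semidirect_product H G \<alpha> =
    \<lparr>carrier = carrier H \<times> carrier G,
     monoid.mult = (\<lambda>(h, g) (h', g'). (h \<otimes>\<^bsub>H\<^esub> \<alpha> g h', g \<otimes>\<^bsub>G\<^esub> g')),
     one = (\<one>\<^bsub>H\<^esub>, \<one>\<^bsub>G\<^esub>)\<rparr>"

end

theory Submission
  imports Defs "Jordan_Normal_Form.Spectral_Radius"
begin

text \<open>
  Write \<open>K\<close> for the semidirect product of \<open>H\<close> by \<open>G\<close>.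

  Suppose that \<open>K\<close> is MAP. Then its subgroup \<open>G\<close> is MAP. Two points of \<open>H\<close> are
  separated by some representation \<open>\<pi>\<close> of \<open>K\<close> of finite dimension, hence by an irreducible
  constituent \<open>\<sigma>\<close> of the restriction \<open>\<rho>\<close> of \<open>\<pi>\<close> to \<open>H\<close>. The unitary \<open>\<pi> (1, g)\<close> makes
  \<open>g \<cdot> \<rho>\<close> equivalent to \<open>\<rho>\<close>, so \<open>g \<cdot> \<sigma>\<close> is again a constituent of \<open>\<rho>\<close>; as \<open>\<rho>\<close> has only
  finitely many constituents up to equivalence, the orbit of \<open>\<sigma>\<close> is finite
  (\<open>constituent_finite_orbit\<close>). Two facts carry this: the decomposition of a representation
  into irreducibles, stated as a finite family of intertwiners \<open>P\<close> into irreducible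
  representations whose kernels have zero intersection (\<open>irreducible_decomposition\<close>), and
  Schur's lemma (\<open>schur_scalar\<close>, \<open>schur_equiv\<close>).

  Conversely, points of \<open>K\<close> with different second coordinates are separated by
  representations of \<open>G\<close>. For points with the same second coordinate, take an irreducible
  representation of \<open>H\<close> of dimension \<open>m\<close> whose orbit is finite, and choose a representative
  \<open>s C\<close> in each class \<open>C\<close> of the orbit. Choose unitaries \<open>V g C\<close> which intertwine
  \<open>g \<cdot> s C\<close> with \<open>s (g \<cdot> C)\<close>. By Schur's lemma they are unique up to a scalar of modulus 1, so
  they multiply like a representation only up to such scalars. These scalars cancel when
  \<open>V g C\<close> is used once on each side of a matrix: on the direct sum, over the orbit, of copies of
  the space of \<open>m \<times> m\<close> matrices, let \<open>(h, g)\<close> send \<open>X\<close> in the summand \<open>C\<close> to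
  \<open>s (g \<cdot> C) h V X V\<^sup>*\<close>, where \<open>V = V g C\<close>, in the summand \<open>g \<cdot> C\<close>. This is a genuine unitary
  representation of \<open>K\<close>, and on \<open>H\<close> it is a multiple of the sum of the \<open>s C\<close>, so it separates
  whatever the given representation separates (\<open>finite_orbit_irrep_separated\<close>).
\<close>

section \<open>Adjoints of complex matrices\<close>

lemma adjoint_dims [simp]:
  "dim_row (mat_adjoint A) = dim_col A" "dim_col (mat_adjoint A) = dim_row A"
  by (simp_all add: mat_adjoint_def)

lemma adjoint_carrier [simp]: "A \<in> carrier_mat n m \<Longrightarrow> mat_adjoint A \<in> carrier_mat m n"
  by (auto intro!: carrier_matI)

lemma index_adjoint [simp]:
  fixes A :: "complex mat"
  assumes "i < dim_col A" "j < dim_row A"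
  shows "mat_adjoint A $$ (i, j) = cnj (A $$ (j, i))"
  using assms by (simp add: mat_adjoint_def mat_of_rows_index)

lemma index_mult_sum:
  fixes A B :: "'a :: semiring_0 mat"
  assumes "i < dim_row A" "j < dim_col B" "dim_col A = dim_row B"
  shows "(A * B) $$ (i, j) = (\<Sum>k<dim_row B. A $$ (i, k) * B $$ (k, j))"
  using assms by (simp add: scalar_prod_def atLeast0LessThan)

lemma adjoint_adjoint [simp]: "mat_adjoint (mat_adjoint A) = (A :: complex mat)"
  by (rule eq_matI) auto

lemma adjoint_mult:
  fixes A B :: "complex mat"
  assumes "dim_col A = dim_row B"
  shows "mat_adjoint (A * B) = mat_adjoint B * mat_adjoint A"
  using assms by (intro eq_matI) (auto simp: index_mult_sum mult.commute simp del: index_mult_mat(1))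

lemma adjoint_one [simp]: "mat_adjoint (1\<^sub>m n :: complex mat) = 1\<^sub>m n"
  by (rule eq_matI) auto

lemma adjoint_smult: "mat_adjoint (c \<cdot>\<^sub>m A) = cnj c \<cdot>\<^sub>m mat_adjoint (A :: complex mat)"
  by (rule eq_matI) auto

text \<open>Associativity with conditions on dimensions only: unlike carrier
  membership, these are discharged by the simplifier without instantiating any dimension.\<close>

lemma mult_assoc_dim:
  fixes A B C :: "'a :: semiring_0 mat"
  assumes "dim_col A = dim_row B" "dim_col B = dim_row C"
  shows "(A * B) * C = A * (B * C)"
  using assms by (intro assoc_mult_mat) auto

lemma mult_vec_assoc_dim:
  fixes A B :: "'a :: semiring_0 mat"
  assumes "dim_col A = dim_row B" "dim_col B = dim_vec v"
  shows "(A * B) *\<^sub>v v = A *\<^sub>v (B *\<^sub>v v)"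
  using assms by (intro assoc_mult_mat_vec) (auto intro: carrier_vecI)

lemma mat_eq_mult_vecI:
  fixes A B :: "complex mat"
  assumes "A \<in> carrier_mat n m" "B \<in> carrier_mat n m"
    and eq: "\<And>v. v \<in> carrier_vec m \<Longrightarrow> A *\<^sub>v v = B *\<^sub>v v"
  shows "A = B"
proof (rule eq_matI)
  fix i j assume ij: "i < dim_row B" "j < dim_col B"
  then have "(A *\<^sub>v unit_vec m j) $ i = (B *\<^sub>v unit_vec m j) $ i"
    using assms by simp
  then show "A $$ (i, j) = B $$ (i, j)" using assms(1,2) ij by auto
qed (use assms in auto)

section \<open>Orthonormal bases of subspaces\<close>

lemma subspace_vec_iff:
  "VectorSpace.subspace class_ring W (module_vec TYPE(complex) n) \<longleftrightarrow>
    W \<subseteq> carrier_vec n \<and> 0\<^sub>v n \<in> W \<and> (\<forall>u\<in>W. \<forall>v\<in>W. u + v \<in> W) \<and>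
    (\<forall>c. \<forall>v\<in>W. c \<cdot>\<^sub>v v \<in> W)"
proof -
  have "module class_ring (module_vec TYPE(complex) n)" by (rule vec_module)
  moreover have "vectorspace class_ring (module_vec TYPE(complex) n)" by (rule vec_vs)
  ultimately show ?thesis
    by (auto simp: VectorSpace.subspace_def submodule_def module_vec_simps)
qed

lemma isometry_iff:
  fixes A :: "complex mat"
  assumes "A \<in> carrier_mat n k"
  shows "mat_adjoint A * A = 1\<^sub>m k \<longleftrightarrow>
    (\<forall>a<k. \<forall>b<k. (\<Sum>i<n. cnj (A $$ (i, a)) * A $$ (i, b)) = (if a = b then 1 else 0))"
  using assms by (auto simp: mat_eq_iff index_mult_sum simp del: index_mult_mat(1))

text \<open>With fewer rows than columns, padding by zero rows would give a
  square isometry, hence a unitary matrix with a vanishing row.\<close>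

lemma isometry_dim_le:
  fixes A :: "complex mat"
  assumes A: "A \<in> carrier_mat n k" and iso: "mat_adjoint A * A = 1\<^sub>m k"
  shows "k \<le> n"
proof (rule ccontr)
  assume "\<not> k \<le> n"
  define B where "B = mat k k (\<lambda>(i, j). if i < n then A $$ (i, j) else 0)"
  have B: "B \<in> carrier_mat k k" by (simp add: B_def)
  have "(\<Sum>i<k. cnj (B $$ (i, a)) * B $$ (i, b)) = (\<Sum>i<n. cnj (A $$ (i, a)) * A $$ (i, b))"
    if "a < k" "b < k" for a b
    using that \<open>\<not> k \<le> n\<close> by (intro sum.mono_neutral_cong_right) (auto simp: B_def)
  then have "mat_adjoint B * B = 1\<^sub>m k"
    using iso isometry_iff[OF A] isometry_iff[OF B] by simp
  then have "B * mat_adjoint B = 1\<^sub>m k"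
    using mat_mult_left_right_inverse[of "mat_adjoint B" k B] B by auto
  then have "(B * mat_adjoint B) $$ (n, n) = 1" using \<open>\<not> k \<le> n\<close> by simp
  moreover have "(B * mat_adjoint B) $$ (n, n) = 0"
  proof -
    have "B $$ (n, j) = 0" if "j < k" for j
      using that \<open>\<not> k \<le> n\<close> by (simp add: B_def)
    then show ?thesis
      using \<open>\<not> k \<le> n\<close> B by (subst index_mult_sum) auto
  qed
  ultimately show False by simp
qed

text \<open>One Gram--Schmidt step: the component of \<open>w\<close> orthogonal to the
  columns of \<open>A\<close>, normalized, becomes a further column.\<close>

lemma isometry_extend:
  fixes A :: "complex mat"
  assumes A: "A \<in> carrier_mat n k" and iso: "mat_adjoint A * A = 1\<^sub>m k"
    and W: "VectorSpace.subspace class_ring W (module_vec TYPE(complex) n)"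
    and range: "\<And>x. x \<in> carrier_vec k \<Longrightarrow> A *\<^sub>v x \<in> W"
    and w: "w \<in> W" "A *\<^sub>v (mat_adjoint A *\<^sub>v w) \<noteq> w"
  shows "\<exists>B. B \<in> carrier_mat n (Suc k) \<and> mat_adjoint B * B = 1\<^sub>m (Suc k) \<and>
    (\<forall>x \<in> carrier_vec (Suc k). B *\<^sub>v x \<in> W)"
proof -
  note W' = W[unfolded subspace_vec_iff]
  have wc: "w \<in> carrier_vec n" using w W' by auto
  define p where "p = mat_adjoint A *\<^sub>v w"
  have p: "p \<in> carrier_vec k" using A by (auto simp: p_def intro!: carrier_vecI)
  define u where "u = w + (- 1) \<cdot>\<^sub>v (A *\<^sub>v p)"
  have Ap: "A *\<^sub>v p \<in> carrier_vec n" using A p by auto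
  have uW: "u \<in> W" unfolding u_def using W' w range[OF p] by blast
  then have u: "u \<in> carrier_vec n" using W' by auto
  have "mat_adjoint A *\<^sub>v (A *\<^sub>v p) = p"
    using A p by (subst mult_vec_assoc_dim[symmetric]) (auto simp: iso)
  then have Au: "mat_adjoint A *\<^sub>v u = 0\<^sub>v k"
    unfolding u_def using A wc Ap p
    by (subst mult_add_distrib_mat_vec)
      (auto simp: p_def[symmetric] mult_mat_vec[OF adjoint_carrier[OF A] Ap])
  have "u \<noteq> 0\<^sub>v n"
  proof
    assume *: "u = 0\<^sub>v n"
    have "A *\<^sub>v p = w"
    proof (rule eq_vecI)
      fix i assume "i < dim_vec w"
      then have i: "i < n" using wc by simp
      then have "u $ i = 0" using * by simp
      then show "(A *\<^sub>v p) $ i = w $ i" using i wc A unfolding u_def by simp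
    qed (use A wc in auto)
    with w(2) show False unfolding p_def by blast
  qed
  then obtain i0 where i0: "i0 < n" "u $ i0 \<noteq> 0"
    using u vec_eq_iff[of u "0\<^sub>v n"] by fastforce
  define s where "s = (\<Sum>i<n. (cmod (u $ i))\<^sup>2)"
  have "s > 0" unfolding s_def using i0 by (intro sum_pos2[of _ i0]) auto
  define e where "e = of_real (1 / sqrt s) \<cdot>\<^sub>v u"
  have e: "e \<in> carrier_vec n" using u by (simp add: e_def)
  have eW: "e \<in> W" unfolding e_def using W' uW by blast
  have ee: "(\<Sum>i<n. cnj (e $ i) * e $ i) = 1"
  proof -
    have "(\<Sum>i<n. cnj (e $ i) * e $ i) = of_real (\<Sum>i<n. (cmod (e $ i))\<^sup>2)"
      by (simp add: complex_norm_square mult.commute del: of_real_power)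
    also have "(\<Sum>i<n. (cmod (e $ i))\<^sup>2) = (\<Sum>i<n. (cmod (u $ i))\<^sup>2 / s)"
      using u \<open>s > 0\<close> by (intro sum.cong) (auto simp: e_def norm_mult power_mult_distrib power_divide norm_divide)
    also have "\<dots> = 1" using \<open>s > 0\<close> by (simp add: s_def flip: sum_divide_distrib)
    finally show ?thesis by simp
  qed
  have Ae: "(\<Sum>i<n. cnj (A $$ (i, a)) * e $ i) = 0" if "a < k" for a
  proof -
    have "mat_adjoint A *\<^sub>v e = 0\<^sub>v k"
      unfolding e_def using A u Au by (subst mult_mat_vec) auto
    then have "(mat_adjoint A *\<^sub>v e) $ a = 0" using that by simp
    then show ?thesis using that A e by (simp add: scalar_prod_def atLeast0LessThan)
  qed
  then have eA: "(\<Sum>i<n. cnj (e $ i) * A $$ (i, a)) = 0" if "a < k" for a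
  proof -
    have "cnj (\<Sum>i<n. cnj (A $$ (i, a)) * e $ i) = 0" using Ae[OF that] by simp
    then show ?thesis by (simp add: mult.commute)
  qed
  define B where "B = mat n (Suc k) (\<lambda>(i, j). if j < k then A $$ (i, j) else e $ i)"
  have B: "B \<in> carrier_mat n (Suc k)" by (simp add: B_def)
  have "mat_adjoint B * B = 1\<^sub>m (Suc k)"
    unfolding isometry_iff[OF B] using iso[unfolded isometry_iff[OF A]] ee Ae eA
    by (auto simp: B_def less_Suc_eq)
  moreover have "B *\<^sub>v x \<in> W" if x: "x \<in> carrier_vec (Suc k)" for x
  proof -
    define y where "y = vec k (\<lambda>i. x $ i)"
    have "B *\<^sub>v x = A *\<^sub>v y + (x $ k) \<cdot>\<^sub>v e"
      using A x e by (intro eq_vecI) (auto simp: B_def y_def scalar_prod_def)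
    moreover have "A *\<^sub>v y \<in> W" by (rule range) (simp add: y_def)
    ultimately show ?thesis using W' eW by simp
  qed
  ultimately show ?thesis using B by blast
qed

text \<open>An orthonormal basis of \<open>W\<close>, as the columns of \<open>A\<close>; then
  \<open>A A\<^sup>*\<close> is the orthogonal projection onto \<open>W\<close>. The number of columns is bounded by \<open>n\<close>, so
  a maximal orthonormal system exists, and by \<open>isometry_extend\<close> it spans \<open>W\<close>.\<close>

lemma orthonormal_basis_exists:
  assumes W: "VectorSpace.subspace class_ring W (module_vec TYPE(complex) n)"
  shows "\<exists>k A. A \<in> carrier_mat n k \<and> mat_adjoint A * A = 1\<^sub>m k \<and>
    (\<forall>x \<in> carrier_vec k. A *\<^sub>v x \<in> W) \<and> (\<forall>w \<in> W. A *\<^sub>v (mat_adjoint A *\<^sub>v w) = w)"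
proof -
  define P where "P = (\<lambda>k. \<exists>A :: complex mat. A \<in> carrier_mat n k \<and> mat_adjoint A * A = 1\<^sub>m k \<and>
    (\<forall>x \<in> carrier_vec k. A *\<^sub>v x \<in> W))"
  have "(0\<^sub>m n 0 :: complex mat) *\<^sub>v x = 0\<^sub>v n" if "x \<in> carrier_vec 0" for x
    using that by (intro eq_vecI) (auto simp: scalar_prod_def)
  then have "P 0" unfolding P_def using W
    by (intro exI[of _ "0\<^sub>m n 0"]) (auto simp: subspace_vec_iff)
  moreover have "\<forall>k. P k \<longrightarrow> k \<le> n" unfolding P_def using isometry_dim_le by blast
  ultimately obtain k where k: "P k" "\<And>l. P l \<Longrightarrow> l \<le> k"
    using GreatestI_nat[of P 0 n] Greatest_le_nat[of P _ n] by blast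
  then obtain A where A: "A \<in> carrier_mat n k" "mat_adjoint A * A = 1\<^sub>m k"
    "\<And>x. x \<in> carrier_vec k \<Longrightarrow> A *\<^sub>v x \<in> W" unfolding P_def by blast
  have "A *\<^sub>v (mat_adjoint A *\<^sub>v w) = w" if "w \<in> W" for w
  proof (rule ccontr)
    assume "A *\<^sub>v (mat_adjoint A *\<^sub>v w) \<noteq> w"
    from isometry_extend[OF A(1,2) W A(3) that this] have "P (Suc k)" unfolding P_def by blast
    then show False using k(2) by fastforce
  qed
  with A show ?thesis by blast
qed

section \<open>Unitary representations, intertwiners and Schur's lemma\<close>

definition unitary_mat :: "nat \<Rightarrow> complex mat \<Rightarrow> bool" where
  "unitary_mat n U \<longleftrightarrow> U \<in> carrier_mat n n \<and> mat_adjoint U * U = 1\<^sub>m n \<and> U * mat_adjoint U = 1\<^sub>m n"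

lemma in_unitary_group: "U \<in> carrier (unitary_group n) \<longleftrightarrow> unitary_mat n U"
  by (auto simp: unitary_group_def unitary_mat_def)

lemma unitary_matI:
  assumes "U \<in> carrier_mat n n" "mat_adjoint U * U = 1\<^sub>m n"
  shows "unitary_mat n U"
  using assms mat_mult_left_right_inverse[of "mat_adjoint U" n U] by (auto simp: unitary_mat_def)

lemma unitary_matD:
  assumes "unitary_mat n U"
  shows "U \<in> carrier_mat n n" "dim_row U = n" "dim_col U = n"
    "mat_adjoint U * U = 1\<^sub>m n" "U * mat_adjoint U = 1\<^sub>m n"
  using assms by (auto simp: unitary_mat_def)

lemma unitary_mat_adjoint: "unitary_mat n U \<Longrightarrow> unitary_mat n (mat_adjoint U)"
  by (auto simp: unitary_mat_def)

lemma unitary_mat_mult: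
  assumes U: "unitary_mat n U" and V: "unitary_mat n V"
  shows "unitary_mat n (U * V)"
proof (rule unitary_matI)
  note [simp] = unitary_matD[OF U] unitary_matD[OF V]
  show "U * V \<in> carrier_mat n n" by (auto intro!: carrier_matI)
  have "mat_adjoint U * (U * V) = V"
    using unitary_matD(1)[OF V] by (simp flip: mult_assoc_dim)
  then show "mat_adjoint (U * V) * (U * V) = 1\<^sub>m n"
    by (simp add: adjoint_mult mult_assoc_dim)
qed

lemma unitary_rep_iff:
  "unitary_rep H n \<rho> \<longleftrightarrow> (\<forall>x\<in>carrier H. unitary_mat n (\<rho> x)) \<and>
    (\<forall>x\<in>carrier H. \<forall>y\<in>carrier H. \<rho> (x \<otimes>\<^bsub>H\<^esub> y) = \<rho> x * \<rho> y) \<and> \<rho> \<in> extensional (carrier H)"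
  by (auto simp: unitary_rep_def hom_def in_unitary_group[symmetric] Pi_iff) (auto simp: unitary_group_def)

lemma unitary_rep_unitary: "unitary_rep H n \<rho> \<Longrightarrow> x \<in> carrier H \<Longrightarrow> unitary_mat n (\<rho> x)"
  by (simp add: unitary_rep_iff)

lemma unitary_rep_carrier: "unitary_rep H n \<rho> \<Longrightarrow> x \<in> carrier H \<Longrightarrow> \<rho> x \<in> carrier_mat n n"
  by (simp add: unitary_rep_iff unitary_mat_def)

lemma unitary_rep_mult:
  "unitary_rep H n \<rho> \<Longrightarrow> x \<in> carrier H \<Longrightarrow> y \<in> carrier H \<Longrightarrow> \<rho> (x \<otimes>\<^bsub>H\<^esub> y) = \<rho> x * \<rho> y"
  by (simp add: unitary_rep_iff)

lemma unitary_rep_compose: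
  assumes "unitary_rep K n \<pi>" and "f \<in> hom H K" and "\<And>x y. x \<in> carrier H \<Longrightarrow> y \<in> carrier H \<Longrightarrow> x \<otimes>\<^bsub>H\<^esub> y \<in> carrier H"
  shows "unitary_rep H n (\<lambda>x\<in>carrier H. \<pi> (f x))"
  using assms by (auto simp: unitary_rep_iff hom_def Pi_iff)

lemma (in group) unitary_rep_one:
  assumes "unitary_rep G n \<rho>"
  shows "\<rho> \<one> = 1\<^sub>m n"
proof -
  note u = unitary_rep_unitary[OF assms one_closed]
  note [simp] = unitary_matD(2-)[OF u]
  have "\<rho> \<one> * \<rho> \<one> = \<rho> \<one>" using unitary_rep_mult[OF assms one_closed one_closed] by simp
  then have "mat_adjoint (\<rho> \<one>) * (\<rho> \<one> * \<rho> \<one>) = 1\<^sub>m n" by simp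
  moreover have "mat_adjoint (\<rho> \<one>) * (\<rho> \<one> * \<rho> \<one>) = \<rho> \<one>"
    using unitary_matD(1)[OF u] by (subst mult_assoc_dim[symmetric]) auto
  ultimately show ?thesis by simp
qed

lemma (in group) unitary_rep_inv:
  assumes \<rho>: "unitary_rep G n \<rho>" and x: "x \<in> carrier G"
  shows "\<rho> (inv x) = mat_adjoint (\<rho> x)"
proof -
  have ux: "unitary_mat n (\<rho> x)" and ui: "unitary_mat n (\<rho> (inv x))"
    using unitary_rep_unitary[OF \<rho>] x by auto
  note [simp] = unitary_matD(2-)[OF ux] unitary_matD(2-)[OF ui]
  have "\<rho> (inv x) * \<rho> x = 1\<^sub>m n"
    using unitary_rep_mult[OF \<rho>, of "inv x" x] x unitary_rep_one[OF \<rho>] by simp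
  then have "\<rho> (inv x) * \<rho> x * mat_adjoint (\<rho> x) = mat_adjoint (\<rho> x)"
    using unitary_matD(1)[OF ux] by simp
  then show ?thesis
    using unitary_matD(1)[OF ui] by (simp add: mult_assoc_dim)
qed

lemma (in group) unitary_rep_dim_unique:
  assumes "unitary_rep G n \<rho>" "unitary_rep G m \<rho>"
  shows "n = m"
  using unitary_rep_carrier[OF assms(1) one_closed] unitary_rep_carrier[OF assms(2) one_closed] by auto

definition intertwiner ::
    "('a, 'm) monoid_scheme \<Rightarrow> nat \<Rightarrow> ('a \<Rightarrow> complex mat) \<Rightarrow> nat \<Rightarrow> ('a \<Rightarrow> complex mat) \<Rightarrow> complex mat \<Rightarrow> bool"
  where "intertwiner H m \<sigma> n \<tau> T \<longleftrightarrow> T \<in> carrier_mat n m \<and> (\<forall>x\<in>carrier H. T * \<sigma> x = \<tau> x * T)"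

lemma intertwiner_compose:
  assumes "unitary_rep H l \<rho>" "unitary_rep H m \<sigma>" "unitary_rep H n \<tau>"
    "intertwiner H l \<rho> m \<sigma> S" "intertwiner H m \<sigma> n \<tau> T"
  shows "intertwiner H l \<rho> n \<tau> (T * S)"
  unfolding intertwiner_def
proof safe
  show "T * S \<in> carrier_mat n l" using assms(4,5) by (auto simp: intertwiner_def)
  fix x assume x: "x \<in> carrier H"
  note c = unitary_rep_carrier[OF assms(1) x] unitary_rep_carrier[OF assms(2) x] unitary_rep_carrier[OF assms(3) x]
  have S: "S \<in> carrier_mat m l" "S * \<rho> x = \<sigma> x * S" and T: "T \<in> carrier_mat n m" "T * \<sigma> x = \<tau> x * T"
    using assms(4,5) x by (auto simp: intertwiner_def)
  have "T * S * \<rho> x = T * (S * \<rho> x)" using c S(1) T(1) by (simp add: mult_assoc_dim)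
  also have "\<dots> = T * \<sigma> x * S" unfolding S(2) using c S(1) T(1) by (simp add: mult_assoc_dim)
  also have "\<dots> = \<tau> x * (T * S)" unfolding T(2) using c S(1) T(1) by (simp add: mult_assoc_dim)
  finally show "T * S * \<rho> x = \<tau> x * (T * S)" .
qed

text \<open>Taking adjoints turns \<open>\<sigma> x\<close> into \<open>\<sigma> x\<inverse>\<close>, which only
  permutes the conditions on an intertwiner.\<close>

lemma (in group) intertwiner_adjoint:
  assumes \<sigma>: "unitary_rep G m \<sigma>" and \<tau>: "unitary_rep G n \<tau>" and T: "intertwiner G m \<sigma> n \<tau> T"
  shows "intertwiner G n \<tau> m \<sigma> (mat_adjoint T)"
  unfolding intertwiner_def
proof safe
  have Tc: "T \<in> carrier_mat n m" using T by (simp add: intertwiner_def)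
  then show "mat_adjoint T \<in> carrier_mat m n" by simp
  fix x assume x: "x \<in> carrier G"
  note c = unitary_rep_carrier[OF \<sigma> x] unitary_rep_carrier[OF \<tau> x]
  have "T * mat_adjoint (\<sigma> x) = mat_adjoint (\<tau> x) * T"
    using T x unitary_rep_inv[OF \<sigma> x] unitary_rep_inv[OF \<tau> x]
    by (auto simp: intertwiner_def dest!: bspec[of _ _ "inv x"])
  then have "mat_adjoint (T * mat_adjoint (\<sigma> x)) = mat_adjoint (mat_adjoint (\<tau> x) * T)" by simp
  then show "mat_adjoint T * \<tau> x = \<sigma> x * mat_adjoint T"
    using c Tc by (simp add: adjoint_mult)
qed

lemma irreducible_repD:
  assumes "irreducible_rep H n \<rho>"
  shows "unitary_rep H n \<rho>" "n > 0"
  using assms by (auto simp: irreducible_rep_def)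

text \<open>An eigenspace of an intertwiner is invariant, and some eigenspace is nonzero
  because \<open>\<complex>\<close> is algebraically closed.\<close>

lemma schur_scalar:
  assumes irr: "irreducible_rep H n \<sigma>" and T: "intertwiner H n \<sigma> n \<sigma> T"
  shows "\<exists>c. T = c \<cdot>\<^sub>m 1\<^sub>m n"
proof -
  note rep = irreducible_repD[OF irr]
  have Tc: "T \<in> carrier_mat n n" using T by (simp add: intertwiner_def)
  obtain c where "c \<in> spectrum T" using spectrum_non_empty[OF Tc rep(2)] by auto
  then obtain v where v: "v \<in> carrier_vec n" "v \<noteq> 0\<^sub>v n" "T *\<^sub>v v = c \<cdot>\<^sub>v v"
    using Tc by (auto simp: spectrum_def eigenvalue_def eigenvector_def)
  define W where "W = {v \<in> carrier_vec n. T *\<^sub>v v = c \<cdot>\<^sub>v v}"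
  have "invariant_subspace H n \<sigma> W"
    unfolding invariant_subspace_def subspace_vec_iff
  proof (intro conjI ballI allI)
    show "0\<^sub>v n \<in> W" using Tc by (auto simp: W_def)
    fix u v assume "u \<in> W" "v \<in> W"
    then show "u + v \<in> W"
      using Tc by (auto simp: W_def mult_add_distrib_mat_vec smult_add_distrib_vec)
  next
    fix d v assume "v \<in> W"
    then show "d \<cdot>\<^sub>v v \<in> W"
      using Tc by (auto simp: W_def mult_mat_vec smult_smult_assoc mult.commute)
  next
    fix h w assume h: "h \<in> carrier H" and w: "w \<in> W"
    note hc = unitary_rep_carrier[OF rep(1) h]
    have "T *\<^sub>v (\<sigma> h *\<^sub>v w) = (T * \<sigma> h) *\<^sub>v w"
      using Tc hc w by (auto simp: W_def mult_vec_assoc_dim)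
    also have "\<dots> = \<sigma> h *\<^sub>v (T *\<^sub>v w)"
      using T h Tc hc w by (auto simp: W_def intertwiner_def mult_vec_assoc_dim)
    also have "\<dots> = c \<cdot>\<^sub>v (\<sigma> h *\<^sub>v w)"
      using w hc by (auto simp: W_def mult_mat_vec)
    finally show "\<sigma> h *\<^sub>v w \<in> W" using hc w by (auto simp: W_def)
  qed (auto simp: W_def)
  moreover have "v \<in> W" using v by (simp add: W_def)
  ultimately have W: "W = carrier_vec n"
    using irr v(2) unfolding irreducible_rep_def by blast
  have "T = c \<cdot>\<^sub>m 1\<^sub>m n"
  proof (rule mat_eq_mult_vecI[OF Tc])
    fix v :: "complex vec" assume v: "v \<in> carrier_vec n"
    then have "T *\<^sub>v v = c \<cdot>\<^sub>v v" using W by (auto simp: W_def)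
    also have "\<dots> = (c \<cdot>\<^sub>m 1\<^sub>m n) *\<^sub>v v"
      using v by (intro eq_vecI) auto
    finally show "T *\<^sub>v v = (c \<cdot>\<^sub>m 1\<^sub>m n) *\<^sub>v v" .
  qed auto
  then show ?thesis by blast
qed

lemma unitary_equivI:
  assumes \<rho>: "irreducible_rep H n \<rho>" and \<sigma>: "irreducible_rep H n \<sigma>"
    and U: "unitary_mat n U" "intertwiner H n \<rho> n \<sigma> U"
  shows "(\<rho>, \<sigma>) \<in> unitary_equiv H"
proof -
  have "U \<in> carrier (unitary_group n)" using U(1) by (simp add: in_unitary_group)
  then show ?thesis
    using irreducible_repD(1)[OF \<rho>] irreducible_repD(1)[OF \<sigma>] \<rho> \<sigma> U(2)
    unfolding unitary_equiv_def fd_irreps_def intertwiner_def by blast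
qed

lemma scaled_isometry:
  fixes A :: "complex mat"
  assumes A: "A \<in> carrier_mat n m" and "A \<noteq> 0\<^sub>m n m" and eq: "mat_adjoint A * A = c \<cdot>\<^sub>m 1\<^sub>m m"
  shows "\<exists>s. mat_adjoint (s \<cdot>\<^sub>m A) * (s \<cdot>\<^sub>m A) = 1\<^sub>m m"
proof -
  obtain i j where ij: "i < n" "j < m" "A $$ (i, j) \<noteq> 0"
    using assms(1,2) by (auto simp: mat_eq_iff)
  define r where "r = (\<Sum>i<n. (cmod (A $$ (i, j)))\<^sup>2)"
  have "r > 0" unfolding r_def using ij by (intro sum_pos2[of _ i]) auto
  have "c = (mat_adjoint A * A) $$ (j, j)" unfolding eq using ij by simp
  also have "\<dots> = of_real r"
    using A ij by (simp add: r_def index_mult_sum complex_norm_square mult.commute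
      del: index_mult_mat(1) of_real_power)
  finally have c: "c = of_real r" .
  define s where "s = complex_of_real (1 / sqrt r)"
  have "mat_adjoint (s \<cdot>\<^sub>m A) * (s \<cdot>\<^sub>m A) = (cnj s * s * c) \<cdot>\<^sub>m 1\<^sub>m m"
    using A unfolding adjoint_smult
    by (subst mult_smult_assoc_mat[of _ m n _ m], simp, simp, subst mult_smult_distrib[of _ m n _ m])
       (auto simp: eq intro!: eq_matI)
  also have "cnj s * s * c = 1"
    using \<open>r > 0\<close> unfolding s_def c by (simp add: field_simps flip: of_real_mult)
  finally show ?thesis by (intro exI[of _ s]) (auto intro!: eq_matI)
qed

text \<open>Both \<open>T\<^sup>* T\<close> and \<open>T T\<^sup>*\<close> commute with an irreducible
  representation, so both are scalar. Hence \<open>T\<close> and \<open>T\<^sup>*\<close> are multiples of isometries, which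
  forces equal dimensions and makes a multiple of \<open>T\<close> unitary.\<close>

lemma (in group) schur_equiv:
  assumes irr\<sigma>: "irreducible_rep G m \<sigma>" and irr\<tau>: "irreducible_rep G n \<tau>"
    and T: "intertwiner G m \<sigma> n \<tau> T" and "T \<noteq> 0\<^sub>m n m"
  shows "(\<sigma>, \<tau>) \<in> unitary_equiv G"
proof -
  note \<sigma> = irreducible_repD[OF irr\<sigma>] and \<tau> = irreducible_repD[OF irr\<tau>]
  have Tc: "T \<in> carrier_mat n m" using T by (simp add: intertwiner_def)
  note T' = intertwiner_adjoint[OF \<sigma>(1) \<tau>(1) T]
  have "mat_adjoint T \<noteq> 0\<^sub>m m n"
  proof
    assume "mat_adjoint T = 0\<^sub>m m n"
    then have "T = mat_adjoint (0\<^sub>m m n)" by (metis adjoint_adjoint)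
    also have "\<dots> = 0\<^sub>m n m" by (rule eq_matI) auto
    finally show False using assms(4) by blast
  qed
  obtain c where c: "mat_adjoint T * T = c \<cdot>\<^sub>m 1\<^sub>m m"
    using schur_scalar[OF irr\<sigma> intertwiner_compose[OF \<sigma>(1) \<tau>(1) \<sigma>(1) T T']] by blast
  obtain d where d: "mat_adjoint (mat_adjoint T) * mat_adjoint T = d \<cdot>\<^sub>m 1\<^sub>m n"
    using schur_scalar[OF irr\<tau> intertwiner_compose[OF \<tau>(1) \<sigma>(1) \<tau>(1) T' T]] by auto
  obtain s where s: "mat_adjoint (s \<cdot>\<^sub>m T) * (s \<cdot>\<^sub>m T) = 1\<^sub>m m"
    using scaled_isometry[OF Tc assms(4) c] by blast
  obtain t where t: "mat_adjoint (t \<cdot>\<^sub>m mat_adjoint T) * (t \<cdot>\<^sub>m mat_adjoint T) = 1\<^sub>m n"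
    using scaled_isometry[OF adjoint_carrier[OF Tc] \<open>mat_adjoint T \<noteq> 0\<^sub>m m n\<close> d] by blast
  have "m \<le> n" using isometry_dim_le[OF _ s] Tc by simp
  moreover have "n \<le> m" using isometry_dim_le[OF _ t] Tc by simp
  ultimately have mn: "m = n" by simp
  define U where "U = s \<cdot>\<^sub>m T"
  have U: "unitary_mat n U" using unitary_matI[of U n] s Tc mn by (simp add: U_def)
  have "U * \<sigma> x = \<tau> x * U" if x: "x \<in> carrier G" for x
  proof -
    note c = unitary_rep_carrier[OF \<sigma>(1) x] unitary_rep_carrier[OF \<tau>(1) x]
    have "U * \<sigma> x = s \<cdot>\<^sub>m (T * \<sigma> x)"
      unfolding U_def using Tc c by (intro mult_smult_assoc_mat)
    also have "\<dots> = s \<cdot>\<^sub>m (\<tau> x * T)" using T x by (simp add: intertwiner_def)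
    also have "\<dots> = \<tau> x * U"
      unfolding U_def using Tc c by (intro mult_smult_distrib[symmetric])
    finally show ?thesis .
  qed
  then show ?thesis
    using unitary_equivI[of G n \<sigma> \<tau> U] irr\<sigma> irr\<tau> U mn
    by (simp add: intertwiner_def unitary_mat_def)
qed

section \<open>Unitary equivalence\<close>

text \<open>Membership in \<open>fd_irreps\<close> hides the dimension; it is
  determined by the size of the matrices.\<close>

lemma (in group) irreducible_rep_of_dim:
  assumes "\<rho> \<in> fd_irreps G" "unitary_rep G n \<rho>"
  shows "irreducible_rep G n \<rho>"
  using assms unitary_rep_dim_unique[OF assms(2)] irreducible_repD(1)
  unfolding fd_irreps_def by blast

lemma (in group) unitary_equivE:
  assumes "(\<rho>, \<sigma>) \<in> unitary_equiv G"
  obtains n U where "irreducible_rep G n \<rho>" "irreducible_rep G n \<sigma>" "unitary_mat n U"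
    "intertwiner G n \<rho> n \<sigma> U"
proof -
  from assms obtain n U where *: "\<rho> \<in> fd_irreps G" "\<sigma> \<in> fd_irreps G" "unitary_rep G n \<rho>" "unitary_rep G n \<sigma>"
    "unitary_mat n U" "\<forall>h\<in>carrier G. U * \<rho> h = \<sigma> h * U"
    unfolding unitary_equiv_def in_unitary_group[symmetric] by blast
  show thesis
    by (rule that[of n U]) (use * in \<open>auto simp: irreducible_rep_of_dim intertwiner_def unitary_mat_def\<close>)
qed

lemma intertwiner_one: "unitary_rep H n \<rho> \<Longrightarrow> intertwiner H n \<rho> n \<rho> (1\<^sub>m n)"
  by (auto simp: intertwiner_def left_mult_one_mat[OF unitary_rep_carrier]
    right_mult_one_mat[OF unitary_rep_carrier])

lemma (in group) equiv_unitary_equiv: "equiv (fd_irreps G) (unitary_equiv G)"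
proof (rule equivI)
  show "unitary_equiv G \<subseteq> fd_irreps G \<times> fd_irreps G" by (auto simp: unitary_equiv_def)
  show "refl_on (fd_irreps G) (unitary_equiv G)"
  proof (rule refl_onI)
    fix \<rho> assume "\<rho> \<in> fd_irreps G"
    then obtain n where n: "irreducible_rep G n \<rho>" by (auto simp: fd_irreps_def)
    show "(\<rho>, \<rho>) \<in> unitary_equiv G"
      by (rule unitary_equivI[OF n n _ intertwiner_one[OF irreducible_repD(1)[OF n]]])
        (simp add: unitary_mat_def)
  qed
  show "sym (unitary_equiv G)"
  proof (rule symI)
    fix \<rho> \<sigma> assume "(\<rho>, \<sigma>) \<in> unitary_equiv G"
    then show "(\<sigma>, \<rho>) \<in> unitary_equiv G"
      by (elim unitary_equivE)
        (blast intro: unitary_equivI unitary_mat_adjoint intertwiner_adjoint irreducible_repD(1))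
  qed
  show "trans (unitary_equiv G)"
  proof (rule transI)
    fix \<rho> \<sigma> \<tau> assume "(\<rho>, \<sigma>) \<in> unitary_equiv G" "(\<sigma>, \<tau>) \<in> unitary_equiv G"
    then show "(\<rho>, \<tau>) \<in> unitary_equiv G"
    proof (elim unitary_equivE)
      fix n m U V
      assume r: "irreducible_rep G n \<rho>" "irreducible_rep G n \<sigma>" "irreducible_rep G m \<sigma>" "irreducible_rep G m \<tau>"
        and U: "unitary_mat n U" "intertwiner G n \<rho> n \<sigma> U" "unitary_mat m V" "intertwiner G m \<sigma> m \<tau> V"
      have "m = n" using r unitary_rep_dim_unique irreducible_repD(1) by blast
      with r U show "(\<rho>, \<tau>) \<in> unitary_equiv G"
        by (blast intro: unitary_equivI unitary_mat_mult intertwiner_compose irreducible_repD(1))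
    qed
  qed
qed

text \<open>The operator \<open>V\<^sup>* U\<close> is unitary and, by Schur's lemma, scalar.\<close>

lemma intertwiner_unique_up_to_phase:
  assumes \<sigma>: "irreducible_rep H n \<sigma>" and \<tau>: "unitary_rep H n \<tau>" and "group H"
    and U: "unitary_mat n U" "intertwiner H n \<sigma> n \<tau> U"
    and V: "unitary_mat n V" "intertwiner H n \<sigma> n \<tau> V"
  shows "\<exists>c. cmod c = 1 \<and> U = c \<cdot>\<^sub>m V"
proof -
  interpret group H by fact
  note rep = irreducible_repD[OF \<sigma>]
  note [simp] = unitary_matD[OF U(1)] unitary_matD[OF V(1)]
  have "intertwiner H n \<sigma> n \<sigma> (mat_adjoint V * U)"
    using rep \<tau> U V intertwiner_compose intertwiner_adjoint by blast
  then obtain c where c: "mat_adjoint V * U = c \<cdot>\<^sub>m 1\<^sub>m n" using schur_scalar[OF \<sigma>] by blast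
  have "V * (mat_adjoint V * U) = U" by (simp flip: mult_assoc_dim)
  then have "U = V * (c \<cdot>\<^sub>m 1\<^sub>m n)" unfolding c by simp
  also have "\<dots> = c \<cdot>\<^sub>m V" by (subst mult_smult_distrib[of V n n]) auto
  finally have UV: "U = c \<cdot>\<^sub>m V" .
  have "unitary_mat n (mat_adjoint V * U)" using U V by (simp add: unitary_mat_mult unitary_mat_adjoint)
  then have "(mat_adjoint (c \<cdot>\<^sub>m 1\<^sub>m n) * (c \<cdot>\<^sub>m 1\<^sub>m n)) $$ (0, 0) = (1\<^sub>m n :: complex mat) $$ (0, 0)"
    unfolding c unitary_mat_def by simp
  moreover have "(mat_adjoint (c \<cdot>\<^sub>m 1\<^sub>m n) * (c \<cdot>\<^sub>m 1\<^sub>m n)) $$ (0, 0) = cnj c * c"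
    using rep(2) by (simp add: adjoint_smult mult_smult_assoc_mat[of _ n n _ n] mult_smult_distrib[of _ n n _ n])
  ultimately have "cnj c * c = 1" using rep(2) by simp
  then have "cmod c = 1" using complex_norm_square[of c]
    by (metis mult.commute norm_ge_zero of_real_eq_1_iff power2_eq_1_iff abs_norm_cancel abs_1 abs_minus_cancel)
  with UV show ?thesis by blast
qed

section \<open>Decomposition into irreducible representations\<close>

text \<open>When the range of the isometry \<open>A\<close> is invariant, compression to
  that range is a representation. That \<open>A\<^sup>*\<close> intertwines uses the invariance of the range under
  inverses, that is, under adjoints.\<close>

lemma (in group) compressed_rep:
  assumes \<rho>: "unitary_rep G n \<rho>" and A: "A \<in> carrier_mat n k" and iso: "mat_adjoint A * A = 1\<^sub>m k"
    and inv: "\<And>x. x \<in> carrier G \<Longrightarrow> A * (mat_adjoint A * (\<rho> x * A)) = \<rho> x * A"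
  defines "\<sigma> \<equiv> (\<lambda>x\<in>carrier G. mat_adjoint A * (\<rho> x * A))"
  shows "unitary_rep G k \<sigma>" and "intertwiner G n \<rho> k \<sigma> (mat_adjoint A)"
proof -
  have adj: "mat_adjoint A * \<rho> x = mat_adjoint A * (\<rho> x * (A * mat_adjoint A))" if x: "x \<in> carrier G" for x
  proof -
    have "mat_adjoint (\<rho> x) * A = A * (mat_adjoint A * (mat_adjoint (\<rho> x) * A))"
      using inv[of "inv x"] x unitary_rep_inv[OF \<rho> x] by simp
    then have "mat_adjoint (mat_adjoint (\<rho> x) * A) = mat_adjoint (A * (mat_adjoint A * (mat_adjoint (\<rho> x) * A)))"
      by simp
    then show ?thesis
      using A unitary_rep_carrier[OF \<rho> x] by (simp add: adjoint_mult mult_assoc_dim)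
  qed
  show rep: "unitary_rep G k \<sigma>"
    unfolding unitary_rep_iff
  proof (intro conjI ballI)
    fix x assume x: "x \<in> carrier G"
    note [simp] = unitary_matD(2-)[OF unitary_rep_unitary[OF \<rho> x]]
    have "mat_adjoint (\<sigma> x) * \<sigma> x = mat_adjoint A * (mat_adjoint (\<rho> x) * (A * (mat_adjoint A * (\<rho> x * A))))"
      using x A by (simp add: \<sigma>_def adjoint_mult mult_assoc_dim)
    also have "\<dots> = mat_adjoint A * ((mat_adjoint (\<rho> x) * \<rho> x) * A)"
      unfolding inv[OF x] using A by (subst mult_assoc_dim) auto
    also have "\<dots> = 1\<^sub>m k" using A iso by simp
    finally show "unitary_mat k (\<sigma> x)"
      using A x by (intro unitary_matI) (auto simp: \<sigma>_def intro!: carrier_matI)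
  next
    fix x y assume x: "x \<in> carrier G" and y: "y \<in> carrier G"
    note [simp] = unitary_matD(2,3)[OF unitary_rep_unitary[OF \<rho> x]] unitary_matD(2,3)[OF unitary_rep_unitary[OF \<rho> y]]
    have "\<sigma> x * \<sigma> y = mat_adjoint A * (\<rho> x * (A * (mat_adjoint A * (\<rho> y * A))))"
      using x y A by (simp add: \<sigma>_def mult_assoc_dim)
    also have "\<dots> = \<sigma> (x \<otimes> y)"
      unfolding inv[OF y] using x y A by (simp add: \<sigma>_def unitary_rep_mult[OF \<rho>] mult_assoc_dim)
    finally show "\<sigma> (x \<otimes> y) = \<sigma> x * \<sigma> y" by simp
  qed (simp add: \<sigma>_def)
  show "intertwiner G n \<rho> k \<sigma> (mat_adjoint A)"
    unfolding intertwiner_def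
  proof (intro conjI ballI)
    fix x assume x: "x \<in> carrier G"
    show "mat_adjoint A * \<rho> x = \<sigma> x * mat_adjoint A"
      using A x unitary_rep_carrier[OF \<rho> x] by (subst adj[OF x]) (simp add: \<sigma>_def mult_assoc_dim)
  qed (use A in simp)
qed

lemma (in group) subspace_rep:
  assumes \<rho>: "unitary_rep G n \<rho>" and W: "invariant_subspace G n \<rho> W"
  obtains k A \<sigma> where "A \<in> carrier_mat n k" "mat_adjoint A * A = 1\<^sub>m k"
    "\<forall>x \<in> carrier_vec k. A *\<^sub>v x \<in> W" "\<forall>w \<in> W. A *\<^sub>v (mat_adjoint A *\<^sub>v w) = w"
    "unitary_rep G k \<sigma>" "intertwiner G n \<rho> k \<sigma> (mat_adjoint A)"
proof -
  obtain k A where A: "A \<in> carrier_mat n k" "mat_adjoint A * A = 1\<^sub>m k"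
    "\<forall>x \<in> carrier_vec k. A *\<^sub>v x \<in> W" "\<forall>w \<in> W. A *\<^sub>v (mat_adjoint A *\<^sub>v w) = w"
    using orthonormal_basis_exists W unfolding invariant_subspace_def by blast
  have inv: "A * (mat_adjoint A * (\<rho> x * A)) = \<rho> x * A" if x: "x \<in> carrier G" for x
  proof (rule mat_eq_mult_vecI[of _ n k])
    note c = unitary_rep_carrier[OF \<rho> x]
    show "A * (mat_adjoint A * (\<rho> x * A)) \<in> carrier_mat n k" "\<rho> x * A \<in> carrier_mat n k"
      using A(1) c by auto
    fix v :: "complex vec" assume v: "v \<in> carrier_vec k"
    have "\<rho> x *\<^sub>v (A *\<^sub>v v) \<in> W" using A(3) v W x unfolding invariant_subspace_def by blast
    then have "A *\<^sub>v (mat_adjoint A *\<^sub>v (\<rho> x *\<^sub>v (A *\<^sub>v v))) = \<rho> x *\<^sub>v (A *\<^sub>v v)" using A(4) by blast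
    then show "A * (mat_adjoint A * (\<rho> x * A)) *\<^sub>v v = \<rho> x * A *\<^sub>v v"
      using A(1) c v by (simp add: mult_vec_assoc_dim)
  qed
  show thesis
    using that[OF A compressed_rep(1)[OF \<rho> A(1,2) inv] compressed_rep(2)[OF \<rho> A(1,2) inv]] by simp
qed

lemma (in group) intertwiner_kernel_invariant:
  assumes \<rho>: "unitary_rep G n \<rho>" and \<sigma>: "unitary_rep G k \<sigma>" and P: "intertwiner G n \<rho> k \<sigma> P"
  shows "invariant_subspace G n \<rho> {v \<in> carrier_vec n. P *\<^sub>v v = 0\<^sub>v k}"
proof -
  have Pc: "P \<in> carrier_mat k n" using P by (simp add: intertwiner_def)
  have "P *\<^sub>v (\<rho> x *\<^sub>v v) = 0\<^sub>v k" if x: "x \<in> carrier G" and v: "v \<in> carrier_vec n" "P *\<^sub>v v = 0\<^sub>v k" for x v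
  proof -
    note c = unitary_rep_carrier[OF \<rho> x] unitary_rep_carrier[OF \<sigma> x]
    have "P *\<^sub>v (\<rho> x *\<^sub>v v) = (P * \<rho> x) *\<^sub>v v" using Pc c v by (simp add: mult_vec_assoc_dim)
    also have "\<dots> = \<sigma> x *\<^sub>v (P *\<^sub>v v)"
      using P x Pc c v(1) by (simp add: intertwiner_def mult_vec_assoc_dim)
    also have "\<dots> = 0\<^sub>v k" using v c by auto
    finally show ?thesis .
  qed
  moreover have "\<rho> x *\<^sub>v v \<in> carrier_vec n" if "x \<in> carrier G" "v \<in> carrier_vec n" for x v
    using mult_mat_vec_carrier[OF unitary_rep_carrier[OF \<rho>]] that by blast
  ultimately show ?thesis
    using Pc unfolding invariant_subspace_def subspace_vec_iff
    by (auto simp: mult_add_distrib_mat_vec[OF Pc] mult_mat_vec[OF Pc])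
qed

text \<open>Complete reducibility without direct sums of matrices: the
  members \<open>P\<close> of the family play the role of the projections onto the summands, and the direct sum
  decomposition is replaced by the injectivity of all \<open>P\<close> together. In the inductive step the
  representation is compressed to an invariant subspace and to its orthogonal complement, which
  is the kernel of \<open>A\<^sup>*\<close>.\<close>

lemma (in group) irreducible_decomposition:
  assumes "unitary_rep G n \<rho>"
  shows "\<exists>S. finite S \<and> (\<forall>(m, \<sigma>, P) \<in> S. irreducible_rep G m \<sigma> \<and> intertwiner G n \<rho> m \<sigma> P) \<and>
    (\<forall>v \<in> carrier_vec n. (\<forall>(m, \<sigma>, P) \<in> S. P *\<^sub>v v = 0\<^sub>v m) \<longrightarrow> v = 0\<^sub>v n)"
  using assms
proof (induction n arbitrary: \<rho> rule: less_induct)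
  case (less n \<rho>)
  note \<rho> = less.prems
  consider "n = 0" | "irreducible_rep G n \<rho>" | "n > 0" "\<not> irreducible_rep G n \<rho>" by blast
  then show ?case
  proof cases
    case 1
    then show ?thesis by (intro exI[of _ "{}"]) auto
  next
    case 2
    then show ?thesis
      using intertwiner_one[OF \<rho>] by (intro exI[of _ "{(n, \<rho>, 1\<^sub>m n)}"]) auto
  next
    case 3
    then obtain W where W: "invariant_subspace G n \<rho> W" "W \<noteq> {0\<^sub>v n}" "W \<noteq> carrier_vec n"
      using \<rho> unfolding irreducible_rep_def by blast
    have Wc: "W \<subseteq> carrier_vec n" "0\<^sub>v n \<in> W"
      using W(1) by (auto simp: invariant_subspace_def subspace_vec_iff)
    obtain k A \<sigma> where A: "A \<in> carrier_mat n k" "mat_adjoint A * A = 1\<^sub>m k"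
      "\<forall>x \<in> carrier_vec k. A *\<^sub>v x \<in> W" "\<forall>w \<in> W. A *\<^sub>v (mat_adjoint A *\<^sub>v w) = w"
      and \<sigma>: "unitary_rep G k \<sigma>" "intertwiner G n \<rho> k \<sigma> (mat_adjoint A)"
      by (rule subspace_rep[OF \<rho> W(1)]) (rule that, assumption+)
    obtain l B \<tau> where B: "B \<in> carrier_mat n l" "mat_adjoint B * B = 1\<^sub>m l"
      "\<forall>x \<in> carrier_vec l. B *\<^sub>v x \<in> {v \<in> carrier_vec n. mat_adjoint A *\<^sub>v v = 0\<^sub>v k}"
      "\<forall>w \<in> {v \<in> carrier_vec n. mat_adjoint A *\<^sub>v v = 0\<^sub>v k}. B *\<^sub>v (mat_adjoint B *\<^sub>v w) = w"
      and \<tau>: "unitary_rep G l \<tau>" "intertwiner G n \<rho> l \<tau> (mat_adjoint B)"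
      by (rule subspace_rep[OF \<rho> intertwiner_kernel_invariant[OF \<rho> \<sigma>]]) (rule that, assumption+)
    have joint: "v = 0\<^sub>v n" if v: "v \<in> carrier_vec n" "mat_adjoint A *\<^sub>v v = 0\<^sub>v k" "mat_adjoint B *\<^sub>v v = 0\<^sub>v l" for v
    proof -
      have "v = B *\<^sub>v (mat_adjoint B *\<^sub>v v)" using B(4) v(1,2) by simp
      also have "\<dots> = 0\<^sub>v n" unfolding v(3) using B(1) by auto
      finally show ?thesis .
    qed
    have "k \<noteq> n"
    proof
      assume "k = n"
      then have "A * mat_adjoint A = 1\<^sub>m n"
        using unitary_matI[of A n] A by (simp add: unitary_mat_def)
      then have "v = A *\<^sub>v (mat_adjoint A *\<^sub>v v)" if "v \<in> carrier_vec n" for v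
        using A(1) that by (simp flip: mult_vec_assoc_dim)
      then have "v \<in> W" if "v \<in> carrier_vec n" for v
        using that A(1,3) by (metis adjoint_carrier mult_mat_vec_carrier)
      then show False using Wc W(3) by blast
    qed
    moreover have "k \<le> n" using isometry_dim_le[OF A(1,2)] .
    ultimately have kn: "k < n" by simp
    have "l \<noteq> n"
    proof
      assume "l = n"
      then have "B * mat_adjoint B = 1\<^sub>m n"
        using unitary_matI[of B n] B by (simp add: unitary_mat_def)
      then have *: "v = B *\<^sub>v (mat_adjoint B *\<^sub>v v)" if "v \<in> carrier_vec n" for v
        using B(1) that by (simp flip: mult_vec_assoc_dim)
      have "w = 0\<^sub>v n" if w: "w \<in> W" for w
      proof -
        have wc: "w \<in> carrier_vec n" using w Wc by blast
        have "mat_adjoint B *\<^sub>v w \<in> carrier_vec l"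
          by (rule mult_mat_vec_carrier[OF adjoint_carrier[OF B(1)] wc])
        then have "mat_adjoint A *\<^sub>v w = 0\<^sub>v k" using *[OF wc] B(3) by fastforce
        then have "w = A *\<^sub>v 0\<^sub>v k" using A(4) w by force
        also have "\<dots> = 0\<^sub>v n" using A(1) by auto
        finally show ?thesis .
      qed
      then show False using Wc W(2) by blast
    qed
    moreover have "l \<le> n" using isometry_dim_le[OF B(1,2)] .
    ultimately have ln: "l < n" by simp
    obtain S where S: "finite S" "\<forall>(m, \<sigma>', P) \<in> S. irreducible_rep G m \<sigma>' \<and> intertwiner G k \<sigma> m \<sigma>' P"
      "\<forall>v \<in> carrier_vec k. (\<forall>(m, \<sigma>', P) \<in> S. P *\<^sub>v v = 0\<^sub>v m) \<longrightarrow> v = 0\<^sub>v k"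
      using less.IH[OF kn \<sigma>(1)] by blast
    obtain T where T: "finite T" "\<forall>(m, \<sigma>', P) \<in> T. irreducible_rep G m \<sigma>' \<and> intertwiner G l \<tau> m \<sigma>' P"
      "\<forall>v \<in> carrier_vec l. (\<forall>(m, \<sigma>', P) \<in> T. P *\<^sub>v v = 0\<^sub>v m) \<longrightarrow> v = 0\<^sub>v l"
      using less.IH[OF ln \<tau>(1)] by blast
    define R where "R = (\<lambda>(m, \<sigma>', P). (m, \<sigma>', P * mat_adjoint A)) ` S \<union>
      (\<lambda>(m, \<sigma>', P). (m, \<sigma>', P * mat_adjoint B)) ` T"
    have "finite R" using S(1) T(1) by (simp add: R_def)
    moreover have "irreducible_rep G m \<sigma>' \<and> intertwiner G n \<rho> m \<sigma>' P" if R: "(m, \<sigma>', P) \<in> R" for m \<sigma>' P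
    proof -
      from R consider Q where "(m, \<sigma>', Q) \<in> S" "P = Q * mat_adjoint A"
        | Q where "(m, \<sigma>', Q) \<in> T" "P = Q * mat_adjoint B" unfolding R_def by auto
      then show ?thesis
      proof cases
        case 1
        then have "irreducible_rep G m \<sigma>'" "intertwiner G k \<sigma> m \<sigma>' Q" using S(2) by auto
        then show ?thesis
          using intertwiner_compose[OF \<rho> \<sigma>(1) irreducible_repD(1) \<sigma>(2)] 1(2) by blast
      next
        case 2
        then have "irreducible_rep G m \<sigma>'" "intertwiner G l \<tau> m \<sigma>' Q" using T(2) by auto
        then show ?thesis
          using intertwiner_compose[OF \<rho> \<tau>(1) irreducible_repD(1) \<tau>(2)] 2(2) by blast
      qed
    qed
    moreover have "v = 0\<^sub>v n" if v: "v \<in> carrier_vec n" "\<forall>(m, \<sigma>', P) \<in> R. P *\<^sub>v v = 0\<^sub>v m" for v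
    proof (rule joint[OF v(1)])
      have "P *\<^sub>v (mat_adjoint A *\<^sub>v v) = 0\<^sub>v m" if "(m, \<sigma>', P) \<in> S" for m \<sigma>' P
      proof -
        have "P \<in> carrier_mat m k" using S(2) that by (auto simp: intertwiner_def)
        moreover have "(P * mat_adjoint A) *\<^sub>v v = 0\<^sub>v m" using v(2) that unfolding R_def by force
        ultimately show ?thesis using A(1) v(1) by (simp add: mult_vec_assoc_dim)
      qed
      then have "\<forall>(m, \<sigma>', P) \<in> S. P *\<^sub>v (mat_adjoint A *\<^sub>v v) = 0\<^sub>v m" by auto
      moreover have "mat_adjoint A *\<^sub>v v \<in> carrier_vec k"
        by (rule mult_mat_vec_carrier[OF adjoint_carrier[OF A(1)] v(1)])
      ultimately show "mat_adjoint A *\<^sub>v v = 0\<^sub>v k" using S(3) by blast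
      have "P *\<^sub>v (mat_adjoint B *\<^sub>v v) = 0\<^sub>v m" if "(m, \<sigma>', P) \<in> T" for m \<sigma>' P
      proof -
        have "P \<in> carrier_mat m l" using T(2) that by (auto simp: intertwiner_def)
        moreover have "(P * mat_adjoint B) *\<^sub>v v = 0\<^sub>v m" using v(2) that unfolding R_def by force
        ultimately show ?thesis using B(1) v(1) by (simp add: mult_vec_assoc_dim)
      qed
      then have "\<forall>(m, \<sigma>', P) \<in> T. P *\<^sub>v (mat_adjoint B *\<^sub>v v) = 0\<^sub>v m" by auto
      moreover have "mat_adjoint B *\<^sub>v v \<in> carrier_vec l"
        by (rule mult_mat_vec_carrier[OF adjoint_carrier[OF B(1)] v(1)])
      ultimately show "mat_adjoint B *\<^sub>v v = 0\<^sub>v l" using T(3) by blast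
    qed
    ultimately show ?thesis by (intro exI[of _ R]) auto
  qed
qed

lemma jointly_injective_cancel:
  fixes A B :: "complex mat"
  assumes inj: "\<forall>v \<in> carrier_vec n. (\<forall>(m, \<sigma>, P) \<in> S. P *\<^sub>v v = 0\<^sub>v m) \<longrightarrow> v = 0\<^sub>v n"
    and A: "A \<in> carrier_mat n k" and B: "B \<in> carrier_mat n k"
    and eq: "\<And>m \<sigma> P. (m, \<sigma>, P) \<in> S \<Longrightarrow> P \<in> carrier_mat m n \<and> P * A = P * B"
  shows "A = B"
proof (rule mat_eq_mult_vecI[OF A B])
  fix v :: "complex vec" assume v: "v \<in> carrier_vec k"
  define u where "u = A *\<^sub>v v - B *\<^sub>v v"
  have Av: "A *\<^sub>v v \<in> carrier_vec n" and Bv: "B *\<^sub>v v \<in> carrier_vec n" using A B v by auto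
  have "P *\<^sub>v u = 0\<^sub>v m" if S: "(m, \<sigma>, P) \<in> S" for m \<sigma> P
  proof -
    have P: "P \<in> carrier_mat m n" and PAB: "P * A = P * B" using eq[OF S] by auto
    have "P *\<^sub>v (A *\<^sub>v v) = (P * A) *\<^sub>v v" "P *\<^sub>v (B *\<^sub>v v) = (P * B) *\<^sub>v v"
      using P A B v by (simp_all add: mult_vec_assoc_dim)
    then have "P *\<^sub>v (A *\<^sub>v v) = P *\<^sub>v (B *\<^sub>v v)" using PAB by simp
    moreover have "P *\<^sub>v u = P *\<^sub>v (A *\<^sub>v v) - P *\<^sub>v (B *\<^sub>v v)"
      unfolding u_def by (rule mult_minus_distrib_mat_vec[OF P Av Bv])
    moreover have "P *\<^sub>v (B *\<^sub>v v) \<in> carrier_vec m" using P Bv by auto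
    ultimately show ?thesis by simp
  qed
  then have "u = 0\<^sub>v n" using inj Av Bv unfolding u_def by (auto simp: Ball_def)
  show "A *\<^sub>v v = B *\<^sub>v v"
  proof (rule eq_vecI)
    fix i assume "i < dim_vec (B *\<^sub>v v)"
    then have i: "i < n" using Bv by (metis carrier_vecD)
    then have "(A *\<^sub>v v - B *\<^sub>v v) $ i = 0" using \<open>u = 0\<^sub>v n\<close> unfolding u_def by simp
    then show "(A *\<^sub>v v) $ i = (B *\<^sub>v v) $ i"
      by (subst (asm) index_minus_vec) (use i Bv in \<open>auto simp del: dim_mult_mat_vec index_mult_mat_vec\<close>)
  qed (use A B in auto)
qed

section \<open>The action on the dual\<close>

lemma MAP_separates:
  assumes "MAP K" "x \<in> carrier K" "y \<in> carrier K" "x \<noteq> y"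
  shows "\<exists>n \<pi>. unitary_rep K n \<pi> \<and> \<pi> x \<noteq> \<pi> y"
  using assms unfolding MAP_def separates_points_def fd_reps_def by blast

locale automorphic_action = H: group H + G: group G
  for H :: "('a, 'm) monoid_scheme" and G :: "('b, 'k) monoid_scheme" +
  fixes \<alpha> :: "'b \<Rightarrow> 'a \<Rightarrow> 'a"
  assumes hom_Aut: "\<alpha> \<in> hom G (AutoGroup H)"
begin

lemma aut: "g \<in> carrier G \<Longrightarrow> \<alpha> g \<in> auto H"
  using hom_Aut by (auto simp: hom_def AutoGroup_def)

lemma aut_hom: "g \<in> carrier G \<Longrightarrow> \<alpha> g \<in> hom H H"
  using aut by (simp add: auto_def)

lemma aut_closed [simp]: "g \<in> carrier G \<Longrightarrow> x \<in> carrier H \<Longrightarrow> \<alpha> g x \<in> carrier H"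
  using aut_hom by (auto simp: hom_def)

lemma aut_comp:
  assumes "g \<in> carrier G" "g' \<in> carrier G" "x \<in> carrier H"
  shows "\<alpha> (g \<otimes>\<^bsub>G\<^esub> g') x = \<alpha> g (\<alpha> g' x)"
proof -
  have "\<alpha> (g \<otimes>\<^bsub>G\<^esub> g') = compose (carrier H) (\<alpha> g) (\<alpha> g')"
    using hom_Aut aut assms by (simp add: hom_def AutoGroup_def BijGroup_def auto_def)
  then show ?thesis using assms by (simp add: compose_def)
qed

lemma aut_one [simp]: "x \<in> carrier H \<Longrightarrow> \<alpha> \<one>\<^bsub>G\<^esub> x = x"
  using aut[of "\<one>\<^bsub>G\<^esub>"] aut_comp[of "\<one>\<^bsub>G\<^esub>" "\<one>\<^bsub>G\<^esub>" x]
  by (auto simp: auto_def Bij_def bij_betw_def dest: inj_onD)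

lemma aut_inv_cancel [simp]:
  "g \<in> carrier G \<Longrightarrow> x \<in> carrier H \<Longrightarrow> \<alpha> g (\<alpha> (inv\<^bsub>G\<^esub> g) x) = x"
  "g \<in> carrier G \<Longrightarrow> x \<in> carrier H \<Longrightarrow> \<alpha> (inv\<^bsub>G\<^esub> g) (\<alpha> g x) = x"
  using aut_comp[of g "inv\<^bsub>G\<^esub> g" x] aut_comp[of "inv\<^bsub>G\<^esub> g" g x] by simp_all

lemma aut_preserves_one: "g \<in> carrier G \<Longrightarrow> \<alpha> g \<one>\<^bsub>H\<^esub> = \<one>\<^bsub>H\<^esub>"
  by (rule hom_one[OF aut_hom H.is_group H.is_group])

abbreviation act :: "'b \<Rightarrow> ('a \<Rightarrow> complex mat) \<Rightarrow> 'a \<Rightarrow> complex mat" where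
  "act \<equiv> rep_action H G \<alpha>"

abbreviation equiv_class :: "('a \<Rightarrow> complex mat) \<Rightarrow> ('a \<Rightarrow> complex mat) set" where
  "equiv_class \<rho> \<equiv> unitary_equiv H `` {\<rho>}"

lemma act_apply: "x \<in> carrier H \<Longrightarrow> act g \<rho> x = \<rho> (\<alpha> (inv\<^bsub>G\<^esub> g) x)"
  by (simp add: rep_action_def)

lemma act_unitary_rep:
  assumes "unitary_rep H n \<rho>" "g \<in> carrier G"
  shows "unitary_rep H n (act g \<rho>)"
  unfolding rep_action_def using assms aut_hom by (intro unitary_rep_compose) auto

lemma act_act:
  assumes "g \<in> carrier G" "g' \<in> carrier G"
  shows "act g (act g' \<rho>) = act (g \<otimes>\<^bsub>G\<^esub> g') \<rho>"
  using assms by (auto simp: rep_action_def restrict_def G.inv_mult_group aut_comp)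

lemma act_one: "unitary_rep H n \<rho> \<Longrightarrow> act \<one>\<^bsub>G\<^esub> \<rho> = \<rho>"
  by (auto simp: rep_action_def unitary_rep_def extensional_def restrict_def fun_eq_iff)

lemma act_intertwiner:
  assumes "intertwiner H m \<rho> n \<sigma> T" "g \<in> carrier G"
  shows "intertwiner H m (act g \<rho>) n (act g \<sigma>) T"
  using assms by (auto simp: intertwiner_def act_apply)

lemma act_irreducible:
  assumes \<rho>: "irreducible_rep H n \<rho>" and g: "g \<in> carrier G"
  shows "irreducible_rep H n (act g \<rho>)"
proof -
  have "invariant_subspace H n \<rho> W" if W: "invariant_subspace H n (act g \<rho>) W" for W
    unfolding invariant_subspace_def
  proof (intro conjI ballI)
    fix x w assume "x \<in> carrier H" "w \<in> W"
    then have "act g \<rho> (\<alpha> g x) *\<^sub>v w \<in> W"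
      using W g unfolding invariant_subspace_def by simp
    then show "\<rho> x *\<^sub>v w \<in> W" using g \<open>x \<in> carrier H\<close> by (simp add: act_apply)
  qed (use W in \<open>simp add: invariant_subspace_def\<close>)
  then show ?thesis
    using \<rho> g by (simp add: irreducible_rep_def act_unitary_rep)
qed

lemma act_fd_irreps: "\<rho> \<in> fd_irreps H \<Longrightarrow> g \<in> carrier G \<Longrightarrow> act g \<rho> \<in> fd_irreps H"
  using act_irreducible by (auto simp: fd_irreps_def)

lemma act_equiv:
  assumes "(\<rho>, \<sigma>) \<in> unitary_equiv H" "g \<in> carrier G"
  shows "(act g \<rho>, act g \<sigma>) \<in> unitary_equiv H"
proof -
  obtain n U where "irreducible_rep H n \<rho>" "irreducible_rep H n \<sigma>" "unitary_mat n U"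
    "intertwiner H n \<rho> n \<sigma> U"
    by (rule H.unitary_equivE[OF assms(1)])
  then show ?thesis
    using assms(2) by (intro unitary_equivI[of H n _ _ U] act_irreducible act_intertwiner)
qed

lemma equiv_class_eq_iff:
  "\<rho> \<in> fd_irreps H \<Longrightarrow> \<sigma> \<in> fd_irreps H \<Longrightarrow> equiv_class \<rho> = equiv_class \<sigma> \<longleftrightarrow> (\<rho>, \<sigma>) \<in> unitary_equiv H"
  using eq_equiv_class_iff[OF H.equiv_unitary_equiv] by blast

lemma dual_action_equiv_class:
  assumes \<rho>: "\<rho> \<in> fd_irreps H" and g: "g \<in> carrier G"
  shows "dual_action H G \<alpha> g (equiv_class \<rho>) = equiv_class (act g \<rho>)"
proof -
  have cancel: "act (inv\<^bsub>G\<^esub> g) (act g \<sigma>) = \<sigma>" "act g (act (inv\<^bsub>G\<^esub> g) \<sigma>) = \<sigma>" if "\<sigma> \<in> fd_irreps H" for \<sigma>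
    using that g by (auto simp: act_act fd_irreps_def act_one[OF irreducible_repD(1)])
  have "act g ` equiv_class \<rho> = equiv_class (act g \<rho>)"
  proof (intro equalityI subsetI)
    fix \<tau> assume "\<tau> \<in> act g ` equiv_class \<rho>"
    then show "\<tau> \<in> equiv_class (act g \<rho>)" using act_equiv g by auto
  next
    fix \<tau> assume \<tau>: "\<tau> \<in> equiv_class (act g \<rho>)"
    then have "(act (inv\<^bsub>G\<^esub> g) (act g \<rho>), act (inv\<^bsub>G\<^esub> g) \<tau>) \<in> unitary_equiv H"
      using act_equiv g by auto
    moreover have "\<tau> \<in> fd_irreps H" using \<tau> by (auto simp: unitary_equiv_def)
    ultimately show "\<tau> \<in> act g ` equiv_class \<rho>"
      using cancel \<rho> by (intro image_eqI[of _ _ "act (inv\<^bsub>G\<^esub> g) \<tau>"]) auto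
  qed
  moreover have "equiv_class \<rho> \<in> fd_dual H" using \<rho> by (auto simp: fd_dual_def quotient_def)
  ultimately show ?thesis by (simp add: dual_action_def)
qed

lemma orbit_equiv_class:
  assumes "\<rho> \<in> fd_irreps H"
  shows "orbit G (dual_action H G \<alpha>) (equiv_class \<rho>) = (\<lambda>g. equiv_class (act g \<rho>)) ` carrier G"
  using dual_action_equiv_class[OF assms] by (auto simp: orbit_def)

text \<open>If every \<open>g \<cdot> \<rho>\<close> is equivalent to \<open>\<rho>\<close>, then \<open>G\<close> permutes the
  classes of the constituents of \<open>\<rho>\<close>, and there are finitely many of these: a nonzero intertwiner
  from \<open>g \<cdot> \<sigma>\<close> into \<open>\<rho>\<close> is not annihilated by all members of a decomposition of \<open>\<rho>\<close>, and Schur's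
  lemma identifies \<open>g \<cdot> \<sigma>\<close> with the target of one that does not annihilate it.\<close>

lemma constituent_finite_orbit:
  assumes \<rho>: "unitary_rep H n \<rho>" and \<sigma>: "irreducible_rep H m \<sigma>"
    and P: "intertwiner H n \<rho> m \<sigma> P" "P \<noteq> 0\<^sub>m m n"
    and covariant: "\<And>g. g \<in> carrier G \<Longrightarrow>
      \<exists>U. unitary_mat n U \<and> (\<forall>x \<in> carrier H. U * \<rho> x = \<rho> (\<alpha> g x) * U)"
  shows "\<sigma> \<in> finite_orbit_irreps H G \<alpha>"
proof -
  obtain S where S: "finite S" "\<forall>(m, \<sigma>, P) \<in> S. irreducible_rep H m \<sigma> \<and> intertwiner H n \<rho> m \<sigma> P"
    "\<forall>v \<in> carrier_vec n. (\<forall>(m, \<sigma>, P) \<in> S. P *\<^sub>v v = 0\<^sub>v m) \<longrightarrow> v = 0\<^sub>v n"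
    using H.irreducible_decomposition[OF \<rho>] by blast
  have Pc: "P \<in> carrier_mat m n" using P by (simp add: intertwiner_def)
  note \<sigma>' = irreducible_repD[OF \<sigma>]
  have Q: "intertwiner H m \<sigma> n \<rho> (mat_adjoint P)" using H.intertwiner_adjoint[OF \<rho> \<sigma>'(1) P(1)] .
  have "equiv_class (act g \<sigma>) \<in> (\<lambda>(m, \<tau>, R). equiv_class \<tau>) ` S" if g: "g \<in> carrier G" for g
  proof -
    obtain U where U: "unitary_mat n U" "\<forall>x \<in> carrier H. U * \<rho> x = \<rho> (\<alpha> g x) * U"
      using covariant[OF g] by blast
    note [simp] = unitary_matD(2-)[OF U(1)]
    \<comment> \<open>\<open>P\<^sup>*\<close> embeds \<open>\<sigma>\<close> in \<open>\<rho>\<close>, and \<open>U\<close> carries its image to a copy of \<open>g \<cdot> \<sigma>\<close>.\<close>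
    define T where "T = U * mat_adjoint P"
    have Tc: "T \<in> carrier_mat n m" using Pc unitary_matD(1)[OF U(1)] by (auto simp: T_def)
    have T: "intertwiner H m (act g \<sigma>) n \<rho> T"
      unfolding intertwiner_def
    proof (intro conjI ballI Tc)
      fix x assume x: "x \<in> carrier H"
      define y where "y = \<alpha> (inv\<^bsub>G\<^esub> g) x"
      have y: "y \<in> carrier H" "\<alpha> g y = x" using g x by (auto simp: y_def)
      note c = unitary_rep_carrier[OF \<rho> x] unitary_rep_carrier[OF \<rho> y(1)] unitary_rep_carrier[OF \<sigma>'(1) y(1)]
      have "T * act g \<sigma> x = U * (mat_adjoint P * \<sigma> y)"
        using x c Pc by (simp add: T_def act_apply flip: y_def) (simp add: mult_assoc_dim)
      also have "\<dots> = (U * \<rho> y) * mat_adjoint P"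
        using Q y(1) c Pc by (simp add: intertwiner_def mult_assoc_dim)
      also have "\<dots> = \<rho> x * T"
        using U(2) y c Pc by (simp add: T_def mult_assoc_dim)
      finally show "T * act g \<sigma> x = \<rho> x * T" .
    qed
    have "T \<noteq> 0\<^sub>m n m"
    proof
      assume "T = 0\<^sub>m n m"
      then have "mat_adjoint U * T = 0\<^sub>m n m" using unitary_matD(1)[OF U(1)] by simp
      moreover have "mat_adjoint U * T = mat_adjoint P"
        using Pc by (simp add: T_def flip: mult_assoc_dim)
      ultimately have "mat_adjoint (mat_adjoint P) = mat_adjoint (0\<^sub>m n m)" by simp
      also have "mat_adjoint (0\<^sub>m n m :: complex mat) = 0\<^sub>m m n" by (rule eq_matI) auto
      finally show False using P(2) by simp
    qed
    then obtain k \<tau> R where R: "(k, \<tau>, R) \<in> S" "\<not> (R \<in> carrier_mat k n \<and> R * T = R * 0\<^sub>m n m)"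
      using jointly_injective_cancel[OF S(3) Tc zero_carrier_mat] by blast
    have \<tau>: "irreducible_rep H k \<tau>" and R': "intertwiner H n \<rho> k \<tau> R" using S(2) R(1) by auto
    then have Rc: "R \<in> carrier_mat k n" by (simp add: intertwiner_def)
    then have "R * T \<noteq> 0\<^sub>m k m" using R(2) by simp
    moreover have "intertwiner H m (act g \<sigma>) k \<tau> (R * T)"
      using intertwiner_compose[OF act_unitary_rep[OF \<sigma>'(1) g] \<rho> irreducible_repD(1)[OF \<tau>] T R'] .
    ultimately have "(act g \<sigma>, \<tau>) \<in> unitary_equiv H"
      using H.schur_equiv[OF act_irreducible[OF \<sigma> g] \<tau>] by blast
    then have "equiv_class (act g \<sigma>) = equiv_class \<tau>"
      using equiv_class_eq_iff by (auto simp: unitary_equiv_def)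
    then show ?thesis using R(1) by force
  qed
  then have "(\<lambda>g. equiv_class (act g \<sigma>)) ` carrier G \<subseteq> (\<lambda>(m, \<tau>, R). equiv_class \<tau>) ` S"
    by (rule image_subsetI)
  then have "finite ((\<lambda>g. equiv_class (act g \<sigma>)) ` carrier G)"
    by (rule finite_subset) (simp add: S(1))
  moreover have "\<sigma> \<in> fd_irreps H" using \<sigma> by (auto simp: fd_irreps_def)
  ultimately show ?thesis
    by (simp add: finite_orbit_irreps_def orbit_equiv_class)
qed

section \<open>Restriction from the semidirect product\<close>

abbreviation semi :: "('a \<times> 'b) monoid" where
  "semi \<equiv> semidirect_product H G \<alpha>"

lemma semi_simps [simp]:
  "carrier semi = carrier H \<times> carrier G"
  "(h, g) \<otimes>\<^bsub>semi\<^esub> (h', g') = (h \<otimes>\<^bsub>H\<^esub> \<alpha> g h', g \<otimes>\<^bsub>G\<^esub> g')"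
  by (simp_all add: semidirect_product_def)

lemma MAP_semidirect_imp_MAP_G:
  assumes "MAP semi"
  shows "MAP G"
  unfolding MAP_def separates_points_def
proof (intro ballI impI)
  fix g g' assume g: "g \<in> carrier G" "g' \<in> carrier G" "g \<noteq> g'"
  then obtain \<pi> n where \<pi>: "unitary_rep semi n \<pi>" "\<pi> (\<one>\<^bsub>H\<^esub>, g) \<noteq> \<pi> (\<one>\<^bsub>H\<^esub>, g')"
    using MAP_separates[OF assms, of "(\<one>\<^bsub>H\<^esub>, g)" "(\<one>\<^bsub>H\<^esub>, g')"] by auto
  have "unitary_rep G n (\<lambda>k\<in>carrier G. \<pi> (\<one>\<^bsub>H\<^esub>, k))"
    by (rule unitary_rep_compose[OF \<pi>(1)]) (auto simp: hom_def aut_preserves_one)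
  then have "(\<lambda>k\<in>carrier G. \<pi> (\<one>\<^bsub>H\<^esub>, k)) \<in> fd_reps G" unfolding fd_reps_def by blast
  then show "\<exists>\<rho>\<in>fd_reps G. \<rho> g \<noteq> \<rho> g'"
    by (rule bexI[rotated]) (use \<pi>(2) g in simp)
qed

text \<open>The restriction of a representation \<open>\<pi>\<close> to \<open>H\<close> satisfies the
  covariance hypothesis of \<open>constituent_finite_orbit\<close> with the unitaries \<open>\<pi> (1, g)\<close>.\<close>

lemma MAP_semidirect_imp_separates:
  assumes "MAP semi"
  shows "separates_points H (finite_orbit_irreps H G \<alpha>)"
  unfolding separates_points_def
proof (intro ballI impI)
  fix x y assume xy: "x \<in> carrier H" "y \<in> carrier H" "x \<noteq> y"
  then obtain \<pi> n where \<pi>: "unitary_rep semi n \<pi>" "\<pi> (x, \<one>\<^bsub>G\<^esub>) \<noteq> \<pi> (y, \<one>\<^bsub>G\<^esub>)"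
    using MAP_separates[OF assms, of "(x, \<one>\<^bsub>G\<^esub>)" "(y, \<one>\<^bsub>G\<^esub>)"] by auto
  define \<rho> where "\<rho> = (\<lambda>z\<in>carrier H. \<pi> (z, \<one>\<^bsub>G\<^esub>))"
  have \<rho>: "unitary_rep H n \<rho>"
    unfolding \<rho>_def by (rule unitary_rep_compose[OF \<pi>(1)]) (auto simp: hom_def)
  have covariant: "\<exists>U. unitary_mat n U \<and> (\<forall>z \<in> carrier H. U * \<rho> z = \<rho> (\<alpha> g z) * U)"
    if g: "g \<in> carrier G" for g
  proof (intro exI conjI ballI)
    show "unitary_mat n (\<pi> (\<one>\<^bsub>H\<^esub>, g))" using unitary_rep_unitary[OF \<pi>(1)] g by simp
    fix z assume z: "z \<in> carrier H"
    have "\<pi> (\<one>\<^bsub>H\<^esub>, g) * \<rho> z = \<pi> (\<alpha> g z, g)"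
      using unitary_rep_mult[OF \<pi>(1), of "(\<one>\<^bsub>H\<^esub>, g)" "(z, \<one>\<^bsub>G\<^esub>)"] z g by (simp add: \<rho>_def)
    also have "\<dots> = \<rho> (\<alpha> g z) * \<pi> (\<one>\<^bsub>H\<^esub>, g)"
      using unitary_rep_mult[OF \<pi>(1), of "(\<alpha> g z, \<one>\<^bsub>G\<^esub>)" "(\<one>\<^bsub>H\<^esub>, g)"] z g
      by (simp add: \<rho>_def aut_preserves_one)
    finally show "\<pi> (\<one>\<^bsub>H\<^esub>, g) * \<rho> z = \<rho> (\<alpha> g z) * \<pi> (\<one>\<^bsub>H\<^esub>, g)" .
  qed
  obtain S where S: "\<forall>(m, \<sigma>, P) \<in> S. irreducible_rep H m \<sigma> \<and> intertwiner H n \<rho> m \<sigma> P"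
    "\<forall>v \<in> carrier_vec n. (\<forall>(m, \<sigma>, P) \<in> S. P *\<^sub>v v = 0\<^sub>v m) \<longrightarrow> v = 0\<^sub>v n"
    using H.irreducible_decomposition[OF \<rho>] by blast
  have "\<rho> x \<noteq> \<rho> y" using \<pi>(2) xy by (simp add: \<rho>_def)
  then obtain m \<sigma> P where P: "(m, \<sigma>, P) \<in> S" "\<not> (P \<in> carrier_mat m n \<and> P * \<rho> x = P * \<rho> y)"
    using jointly_injective_cancel[OF S(2) unitary_rep_carrier[OF \<rho> xy(1)] unitary_rep_carrier[OF \<rho> xy(2)]]
    by blast
  have \<sigma>: "irreducible_rep H m \<sigma>" "intertwiner H n \<rho> m \<sigma> P" using S(1) P(1) by auto
  have "P * \<rho> x \<noteq> P * \<rho> y" using P(2) \<sigma>(2) by (auto simp: intertwiner_def)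
  then have "\<sigma> x \<noteq> \<sigma> y" using \<sigma>(2) xy by (auto simp: intertwiner_def)
  moreover have "P \<noteq> 0\<^sub>m m n"
    using \<open>P * \<rho> x \<noteq> P * \<rho> y\<close> unitary_rep_carrier[OF \<rho> xy(1)] unitary_rep_carrier[OF \<rho> xy(2)] by auto
  ultimately show "\<exists>\<sigma>\<in>finite_orbit_irreps H G \<alpha>. \<sigma> x \<noteq> \<sigma> y"
    using constituent_finite_orbit[OF \<rho> \<sigma> _ covariant] by blast
qed

end

section \<open>A representation of the semidirect product from a finite orbit\<close>

text \<open>Representations are required to act on \<open>\<complex>\<^sup>n\<close>, but their matrices are
  more conveniently indexed by a finite set with structure.\<close>

lemma unitary_rep_of_kernel:
  fixes M :: "'k \<Rightarrow> 'i \<Rightarrow> 'i \<Rightarrow> complex" and K :: "('k, 'z) monoid_scheme"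
  assumes "finite I"
    and closed: "\<And>x y. x \<in> carrier K \<Longrightarrow> y \<in> carrier K \<Longrightarrow> x \<otimes>\<^bsub>K\<^esub> y \<in> carrier K"
    and mult: "\<And>x y p q. x \<in> carrier K \<Longrightarrow> y \<in> carrier K \<Longrightarrow> p \<in> I \<Longrightarrow> q \<in> I \<Longrightarrow>
      M (x \<otimes>\<^bsub>K\<^esub> y) p q = (\<Sum>r\<in>I. M x p r * M y r q)"
    and isometry: "\<And>x p q. x \<in> carrier K \<Longrightarrow> p \<in> I \<Longrightarrow> q \<in> I \<Longrightarrow>
      (\<Sum>r\<in>I. cnj (M x r p) * M x r q) = (if p = q then 1 else 0)"
  shows "\<exists>\<pi>. unitary_rep K (card I) \<pi> \<and>
    (\<forall>x\<in>carrier K. \<forall>y\<in>carrier K. \<pi> x = \<pi> y \<longrightarrow> (\<forall>p\<in>I. \<forall>q\<in>I. M x p q = M y p q))"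
proof -
  obtain f where f: "bij_betw f {..<card I} I"
    using ex_bij_betw_nat_finite[OF \<open>finite I\<close>] by (auto simp: atLeast0LessThan)
  let ?n = "card I"
  have fI: "f i \<in> I" if "i < ?n" for i using f that by (auto simp: bij_betw_def)
  have f_inj: "f i = f j \<longleftrightarrow> i = j" if "i < ?n" "j < ?n" for i j
    using f that by (auto simp: bij_betw_def inj_on_def)
  define \<pi> where "\<pi> = (\<lambda>x\<in>carrier K. mat ?n ?n (\<lambda>(i, j). M x (f i) (f j)))"
  have idx: "\<pi> x $$ (i, j) = M x (f i) (f j)" if "x \<in> carrier K" "i < ?n" "j < ?n" for x i j
    using that by (simp add: \<pi>_def)
  have c: "\<pi> x \<in> carrier_mat ?n ?n" if "x \<in> carrier K" for x
    using that by (simp add: \<pi>_def)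
  have "unitary_rep K ?n \<pi>"
    unfolding unitary_rep_iff
  proof (intro conjI ballI)
    fix x assume x: "x \<in> carrier K"
    have "(\<Sum>i<?n. cnj (\<pi> x $$ (i, a)) * \<pi> x $$ (i, b)) = (if a = b then 1 else 0)"
      if "a < ?n" "b < ?n" for a b
    proof -
      have "(\<Sum>i<?n. cnj (\<pi> x $$ (i, a)) * \<pi> x $$ (i, b)) =
          (\<Sum>i<?n. cnj (M x (f i) (f a)) * M x (f i) (f b))"
        using x that by (intro sum.cong) (auto simp: idx)
      also have "\<dots> = (\<Sum>r\<in>I. cnj (M x r (f a)) * M x r (f b))"
        by (rule sum.reindex_bij_betw[OF f])
      also have "\<dots> = (if a = b then 1 else 0)"
        using isometry[OF x fI fI] that f_inj by simp
      finally show ?thesis .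
    qed
    then show "unitary_mat ?n (\<pi> x)"
      by (intro unitary_matI c x) (simp add: isometry_iff[OF c[OF x]])
  next
    fix x y assume x: "x \<in> carrier K" and y: "y \<in> carrier K"
    show "\<pi> (x \<otimes>\<^bsub>K\<^esub> y) = \<pi> x * \<pi> y"
    proof (rule eq_matI)
      fix i j assume "i < dim_row (\<pi> x * \<pi> y)" "j < dim_col (\<pi> x * \<pi> y)"
      then have ij: "i < ?n" "j < ?n" using c[OF x] c[OF y] by auto
      have "(\<pi> x * \<pi> y) $$ (i, j) = (\<Sum>k<?n. \<pi> x $$ (i, k) * \<pi> y $$ (k, j))"
        using c[OF x] c[OF y] ij by (subst index_mult_sum) auto
      also have "\<dots> = (\<Sum>k<?n. M x (f i) (f k) * M y (f k) (f j))"
        using x y ij by (intro sum.cong) (auto simp: idx)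
      also have "\<dots> = (\<Sum>r\<in>I. M x (f i) r * M y r (f j))"
        by (rule sum.reindex_bij_betw[OF f])
      also have "\<dots> = \<pi> (x \<otimes>\<^bsub>K\<^esub> y) $$ (i, j)"
        using x y ij by (simp add: idx closed mult fI)
      finally show "\<pi> (x \<otimes>\<^bsub>K\<^esub> y) $$ (i, j) = (\<pi> x * \<pi> y) $$ (i, j)" by simp
    qed (use c[OF x] c[OF y] c[OF closed[OF x y]] in auto)
  qed (simp add: \<pi>_def)
  moreover have "M x p q = M y p q"
    if "x \<in> carrier K" "y \<in> carrier K" "\<pi> x = \<pi> y" "p \<in> I" "q \<in> I" for x y p q
  proof -
    have "p \<in> f ` {..<?n}" "q \<in> f ` {..<?n}"
      using \<open>p \<in> I\<close> \<open>q \<in> I\<close> by (simp_all add: bij_betw_imp_surj_on[OF f])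
    then obtain i j where "i < ?n" "f i = p" "j < ?n" "f j = q" by fast
    then show ?thesis using idx[of x i j] idx[of y i j] that by simp
  qed
  ultimately show ?thesis by blast
qed

lemma sum_single_fibre:
  fixes F G :: "nat \<Rightarrow> complex"
  assumes "finite Orb" "D0 \<in> Orb"
  shows "(\<Sum>(D, e, f) \<in> Orb \<times> {..<m} \<times> {..<m}. if D = D0 then F e * G f else 0) =
    (\<Sum>e<m. F e) * (\<Sum>f<m. G f)"
proof -
  have "(\<Sum>(D, e, f) \<in> Orb \<times> {..<m} \<times> {..<m}. if D = D0 then F e * G f else 0) =
      (\<Sum>D\<in>Orb. if D = D0 then (\<Sum>e<m. \<Sum>f<m. F e * G f) else 0)"
    by (auto simp: sum.cartesian_product[symmetric] intro!: sum.cong)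
  also have "\<dots> = (\<Sum>e<m. F e) * (\<Sum>f<m. G f)"
    using assms by (simp add: sum_product)
  finally show ?thesis .
qed

context automorphic_action
begin

text \<open>The representation is given by the kernel \<open>M\<close> below, indexed by
  triples of a class in the orbit and the two indices of an \<open>m \<times> m\<close> matrix.\<close>

lemma finite_orbit_irrep_separated:
  assumes \<sigma>: "\<sigma> \<in> finite_orbit_irreps H G \<alpha>"
  shows "\<exists>\<pi>\<in>fd_reps semi. \<forall>x\<in>carrier H. \<forall>y\<in>carrier H. \<forall>g\<in>carrier G.
    \<pi> (x, g) = \<pi> (y, g) \<longrightarrow> \<sigma> x = \<sigma> y"
proof -
  have \<sigma>fd: "\<sigma> \<in> fd_irreps H" using \<sigma> by (simp add: finite_orbit_irreps_def)
  then obtain m where \<sigma>irr: "irreducible_rep H m \<sigma>" by (auto simp: fd_irreps_def)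
  define Orb where "Orb = orbit G (dual_action H G \<alpha>) (equiv_class \<sigma>)"
  have Orb_eq: "Orb = (\<lambda>g. equiv_class (act g \<sigma>)) ` carrier G"
    using orbit_equiv_class[OF \<sigma>fd] by (simp add: Orb_def)
  have finO: "finite Orb" using \<sigma> by (simp add: Orb_def finite_orbit_irreps_def)
  \<comment> \<open>One representative for each class; the action preserves the dimension, so all of them
    have dimension \<open>m\<close>.\<close>
  define s where "s = (\<lambda>C. SOME \<rho>. irreducible_rep H m \<rho> \<and> C = equiv_class \<rho>)"
  have s: "irreducible_rep H m (s C)" "C = equiv_class (s C)" if "C \<in> Orb" for C
  proof -
    have "\<exists>\<rho>. irreducible_rep H m \<rho> \<and> C = equiv_class \<rho>"
      using that \<sigma>irr act_irreducible unfolding Orb_eq by blast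
    then have "irreducible_rep H m (s C) \<and> C = equiv_class (s C)"
      unfolding s_def by (rule someI_ex)
    then show "irreducible_rep H m (s C)" "C = equiv_class (s C)" by auto
  qed
  have s_rep: "unitary_rep H m (s C)" and s_fd: "s C \<in> fd_irreps H" if "C \<in> Orb" for C
    using s(1)[OF that] irreducible_repD(1) by (auto simp: fd_irreps_def)
  define d where "d = dual_action H G \<alpha>"
  have d_class: "d g (equiv_class \<rho>) = equiv_class (act g \<rho>)"
    if "\<rho> \<in> fd_irreps H" "g \<in> carrier G" for \<rho> g
    unfolding d_def using dual_action_equiv_class that by blast
  have dO: "d g C \<in> Orb" if "g \<in> carrier G" "C \<in> Orb" for g C
    using that unfolding Orb_eq by (auto simp: d_class act_fd_irreps \<sigma>fd act_act)
  have dd: "d g (d g' C) = d (g \<otimes>\<^bsub>G\<^esub> g') C" if "g \<in> carrier G" "g' \<in> carrier G" "C \<in> Orb" for g g' C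
    using that unfolding Orb_eq by (auto simp: d_class act_fd_irreps \<sigma>fd act_act G.m_assoc)
  have d1: "d \<one>\<^bsub>G\<^esub> C = C" if "C \<in> Orb" for C
    using that unfolding Orb_eq by (auto simp: d_class act_fd_irreps \<sigma>fd act_act)
  have d_inj: "C = C'" if "g \<in> carrier G" "C \<in> Orb" "C' \<in> Orb" "d g C = d g C'" for g C C'
  proof -
    have undo: "d (inv\<^bsub>G\<^esub> g) (d g B) = B" if "B \<in> Orb" for B
      using that \<open>g \<in> carrier G\<close> by (simp add: dd d1)
    show ?thesis using undo[OF that(2)] unfolding that(4) undo[OF that(3)] by (rule sym)
  qed
  have "\<exists>V. unitary_mat m V \<and> intertwiner H m (act g (s C)) m (s (d g C)) V"
    if g: "g \<in> carrier G" and C: "C \<in> Orb" for g C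
  proof -
    have "equiv_class (act g (s C)) = equiv_class (s (d g C))"
      using d_class[OF s_fd[OF C] g] s(2)[OF C] s(2)[OF dO[OF g C]] by simp
    then have "(act g (s C), s (d g C)) \<in> unitary_equiv H"
      using equiv_class_eq_iff[OF act_fd_irreps[OF s_fd[OF C] g] s_fd[OF dO[OF g C]]] by simp
    then obtain n V where V: "irreducible_rep H n (s (d g C))" "unitary_mat n V"
      "intertwiner H n (act g (s C)) n (s (d g C)) V" by (rule H.unitary_equivE)
    then have "n = m" using H.unitary_rep_dim_unique irreducible_repD(1) s_rep[OF dO[OF g C]] by blast
    then show ?thesis using V by blast
  qed
  then obtain V where V: "\<And>g C. g \<in> carrier G \<Longrightarrow> C \<in> Orb \<Longrightarrow> unitary_mat m (V g C)"
    "\<And>g C. g \<in> carrier G \<Longrightarrow> C \<in> Orb \<Longrightarrow> intertwiner H m (act g (s C)) m (s (d g C)) (V g C)"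
    by metis
  have Vc: "V g C \<in> carrier_mat m m" if "g \<in> carrier G" "C \<in> Orb" for g C
    using unitary_matD(1)[OF V(1)[OF that]] .
  have V_swap: "V g C * s C x = s (d g C) (\<alpha> g x) * V g C"
    if "g \<in> carrier G" "C \<in> Orb" "x \<in> carrier H" for g C x
    using V(2)[OF that(1,2)] that by (auto simp: intertwiner_def act_apply dest!: bspec[of _ _ "\<alpha> g x"])
  \<comment> \<open>Both sides intertwine the same irreducible representations.\<close>
  have cocycle: "\<exists>c. cmod c = 1 \<and> V g (d g' C) * V g' C = c \<cdot>\<^sub>m V (g \<otimes>\<^bsub>G\<^esub> g') C"
    if g: "g \<in> carrier G" and g': "g' \<in> carrier G" and C: "C \<in> Orb" for g g' C
  proof -
    have gg': "g \<otimes>\<^bsub>G\<^esub> g' \<in> carrier G" using g g' by simp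
    note D = dO[OF g' C]
    have "intertwiner H m (act g (act g' (s C))) m (act g (s (d g' C))) (V g' C)"
      using act_intertwiner[OF V(2)[OF g' C] g] .
    then have "intertwiner H m (act g (act g' (s C))) m (s (d g (d g' C))) (V g (d g' C) * V g' C)"
      by (rule intertwiner_compose[rotated 3])
        (use s_rep act_unitary_rep g g' C D dO V(2)[OF g D] in auto)
    then have "intertwiner H m (act (g \<otimes>\<^bsub>G\<^esub> g') (s C)) m (s (d (g \<otimes>\<^bsub>G\<^esub> g') C)) (V g (d g' C) * V g' C)"
      using g g' C by (simp add: act_act dd)
    then show ?thesis
      using intertwiner_unique_up_to_phase[OF act_irreducible[OF s(1)[OF C] gg'] s_rep[OF dO[OF gg' C]]
          H.is_group unitary_mat_mult[OF V(1)[OF g D] V(1)[OF g' C]] _ V(1)[OF gg' C] V(2)[OF gg' C]]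
      by blast
  qed
  define A where "A = (\<lambda>h g C. s (d g C) h * V g C)"
  have A: "unitary_mat m (A h g C)" if "h \<in> carrier H" "g \<in> carrier G" "C \<in> Orb" for h g C
    unfolding A_def
    by (rule unitary_mat_mult[OF unitary_rep_unitary[OF s_rep[OF dO]] V(1)]) (use that in simp_all)
  have Ac: "A h g C \<in> carrier_mat m m" if "h \<in> carrier H" "g \<in> carrier G" "C \<in> Orb" for h g C
    using unitary_matD(1)[OF A[OF that]] .
  define I where "I = Orb \<times> {..<m} \<times> {..<m}"
  \<comment> \<open>The matrix of \<open>X \<mapsto> A X V\<^sup>*\<close> from the summand \<open>C\<close> to the summand \<open>d g C\<close>.\<close>
  define M where "M = (\<lambda>(h, g) (D, a, b) (C, c, e).
    if D = d g C then A h g C $$ (a, c) * cnj (V g C $$ (b, e)) else 0)"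
  \<comment> \<open>Moving \<open>V g\<close> past \<open>h'\<close> applies \<open>\<alpha> g\<close> to \<open>h'\<close>, which is the twist in the product of \<open>semi\<close>.\<close>
  have AA: "A h g (d g' C) * A h' g' C = s (d (g \<otimes>\<^bsub>G\<^esub> g') C) (h \<otimes>\<^bsub>H\<^esub> \<alpha> g h') * (V g (d g' C) * V g' C)"
    if g: "g \<in> carrier G" and g': "g' \<in> carrier G" and C: "C \<in> Orb" and h: "h \<in> carrier H" and h': "h' \<in> carrier H"
    for g g' h h' C
  proof -
    note D = dO[OF g' C]
    note E = dO[OF g D]
    have ah: "\<alpha> g h' \<in> carrier H" using g h' by simp
    note c = unitary_rep_carrier[OF s_rep[OF D] h'] unitary_rep_carrier[OF s_rep[OF E] h]
      unitary_rep_carrier[OF s_rep[OF E] ah] Vc[OF g D] Vc[OF g' C]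
    have "A h g (d g' C) * A h' g' C =
        s (d g (d g' C)) h * ((V g (d g' C) * s (d g' C) h') * V g' C)"
      using c by (simp add: A_def mult_assoc_dim)
    also have "\<dots> = (s (d g (d g' C)) h * s (d g (d g' C)) (\<alpha> g h')) * (V g (d g' C) * V g' C)"
      unfolding V_swap[OF g D h'] using c by (simp add: mult_assoc_dim)
    also have "\<dots> = s (d g (d g' C)) (h \<otimes>\<^bsub>H\<^esub> \<alpha> g h') * (V g (d g' C) * V g' C)"
      by (simp add: unitary_rep_mult[OF s_rep[OF E] h ah])
    finally show ?thesis using dd[OF g g' C] by simp
  qed
  have "\<exists>\<pi>. unitary_rep semi (card I) \<pi> \<and>
    (\<forall>x\<in>carrier semi. \<forall>y\<in>carrier semi. \<pi> x = \<pi> y \<longrightarrow> (\<forall>p\<in>I. \<forall>q\<in>I. M x p q = M y p q))"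
  proof (rule unitary_rep_of_kernel)
    show "finite I" using finO by (simp add: I_def)
    show "x \<otimes>\<^bsub>semi\<^esub> y \<in> carrier semi" if "x \<in> carrier semi" "y \<in> carrier semi" for x y
      using that by (cases x; cases y) auto
  next
    fix x y p q assume "x \<in> carrier semi" "y \<in> carrier semi" "p \<in> I" "q \<in> I"
    then obtain h g h' g' E a b C c e where
      x: "x = (h, g)" "h \<in> carrier H" "g \<in> carrier G" and y: "y = (h', g')" "h' \<in> carrier H" "g' \<in> carrier G"
      and p: "p = (E, a, b)" "E \<in> Orb" "a < m" "b < m" and q: "q = (C, c, e)" "C \<in> Orb" "c < m" "e < m"
      by (auto simp: I_def)
    let ?D = "d g' C"
    note D = dO[OF y(3) q(2)]
    have gg': "g \<otimes>\<^bsub>G\<^esub> g' \<in> carrier G" using x y by simp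
    have hh': "h \<otimes>\<^bsub>H\<^esub> \<alpha> g h' \<in> carrier H" using x y by simp
    obtain z where z: "cmod z = 1" "V g ?D * V g' C = z \<cdot>\<^sub>m V (g \<otimes>\<^bsub>G\<^esub> g') C"
      using cocycle[OF x(3) y(3) q(2)] by blast
    \<comment> \<open>The phase occurs once through \<open>A\<close> and once, conjugated, through \<open>V\<close>.\<close>
    have zz: "z * cnj z = 1" using z(1) complex_norm_square[of z] by simp
    have "(\<Sum>r\<in>I. M x p r * M y r q) = (\<Sum>(D, i, j)\<in>I. if D = ?D then
        (if E = d g ?D then A h g ?D $$ (a, i) * A h' g' C $$ (i, c) else 0) *
        (cnj (V g ?D $$ (b, j)) * cnj (V g' C $$ (j, e))) else 0)"
      by (intro sum.cong) (auto simp: M_def x y p q)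
    also have "\<dots> = (\<Sum>i<m. if E = d g ?D then A h g ?D $$ (a, i) * A h' g' C $$ (i, c) else 0) *
        (\<Sum>j<m. cnj (V g ?D $$ (b, j)) * cnj (V g' C $$ (j, e)))"
      unfolding I_def by (rule sum_single_fibre[OF finO D])
    also have "(\<Sum>i<m. if E = d g ?D then A h g ?D $$ (a, i) * A h' g' C $$ (i, c) else 0) =
        (if E = d g ?D then (A h g ?D * A h' g' C) $$ (a, c) else 0)"
      using Ac[OF x(2,3) D] Ac[OF y(2,3) q(2)] p q by (subst index_mult_sum) auto
    also have "(\<Sum>j<m. cnj (V g ?D $$ (b, j)) * cnj (V g' C $$ (j, e))) = cnj ((V g ?D * V g' C) $$ (b, e))"
      using Vc[OF x(3) D] Vc[OF y(3) q(2)] p q by (subst index_mult_sum) auto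
    also have "A h g ?D * A h' g' C = z \<cdot>\<^sub>m A (h \<otimes>\<^bsub>H\<^esub> \<alpha> g h') (g \<otimes>\<^bsub>G\<^esub> g') C"
      using AA[OF x(3) y(3) q(2) x(2) y(2)] unfolding z(2)
        mult_smult_distrib[OF unitary_rep_carrier[OF s_rep[OF dO[OF gg' q(2)]] hh'] Vc[OF gg' q(2)]]
      by (simp add: A_def)
    also have "(if E = d g ?D then (z \<cdot>\<^sub>m A (h \<otimes>\<^bsub>H\<^esub> \<alpha> g h') (g \<otimes>\<^bsub>G\<^esub> g') C) $$ (a, c) else 0) *
        cnj ((V g ?D * V g' C) $$ (b, e)) = (z * cnj z) * M (x \<otimes>\<^bsub>semi\<^esub> y) p q"
      unfolding z(2) using Ac[OF hh' gg' q(2)] Vc[OF gg' q(2)] p q x y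
      by (simp add: M_def dd mult_ac)
    finally show "M (x \<otimes>\<^bsub>semi\<^esub> y) p q = (\<Sum>r\<in>I. M x p r * M y r q)" by (simp add: zz)
  next
    fix x p q assume "x \<in> carrier semi" "p \<in> I" "q \<in> I"
    then obtain h g C a b C' a' b' where
      x: "x = (h, g)" "h \<in> carrier H" "g \<in> carrier G"
      and p: "p = (C, a, b)" "C \<in> Orb" "a < m" "b < m" and q: "q = (C', a', b')" "C' \<in> Orb" "a' < m" "b' < m"
      by (auto simp: I_def)
    show "(\<Sum>r\<in>I. cnj (M x r p) * M x r q) = (if p = q then 1 else 0)"
    proof (cases "C = C'")
      case False
      then have "d g C \<noteq> d g C'" using d_inj x p q by blast
      then have "cnj (M x r p) * M x r q = 0" if "r \<in> I" for r
        by (cases r) (auto simp: M_def x p q)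
      then show ?thesis using False p q by simp
    next
      case True
      have "(\<Sum>r\<in>I. cnj (M x r p) * M x r q) = (\<Sum>(D, i, j)\<in>I. if D = d g C then
          (cnj (A h g C $$ (i, a)) * A h g C $$ (i, a')) *
          cnj (cnj (V g C $$ (j, b)) * V g C $$ (j, b')) else 0)"
        using True by (intro sum.cong) (auto simp: M_def x p q)
      also have "\<dots> = (\<Sum>i<m. cnj (A h g C $$ (i, a)) * A h g C $$ (i, a')) *
          (\<Sum>j<m. cnj (cnj (V g C $$ (j, b)) * V g C $$ (j, b')))"
        unfolding I_def by (rule sum_single_fibre[OF finO dO[OF x(3) p(2)]])
      also have "(\<Sum>i<m. cnj (A h g C $$ (i, a)) * A h g C $$ (i, a')) = (if a = a' then 1 else 0)"
        using unitary_matD(4)[OF A[OF x(2,3) p(2)]] isometry_iff[OF Ac[OF x(2,3) p(2)]] p q by blast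
      also have "(\<Sum>j<m. cnj (cnj (V g C $$ (j, b)) * V g C $$ (j, b'))) =
          cnj (\<Sum>j<m. cnj (V g C $$ (j, b)) * V g C $$ (j, b'))" by simp
      also have "(\<Sum>j<m. cnj (V g C $$ (j, b)) * V g C $$ (j, b')) = (if b = b' then 1 else 0)"
        using unitary_matD(4)[OF V(1)[OF x(3) p(2)]] isometry_iff[OF Vc[OF x(3) p(2)]] p q by blast
      finally show ?thesis using True p q by simp
    qed
  qed
  then obtain \<pi> where \<pi>: "unitary_rep semi (card I) \<pi>"
    and ker: "\<And>x y p q. x \<in> carrier semi \<Longrightarrow> y \<in> carrier semi \<Longrightarrow> \<pi> x = \<pi> y \<Longrightarrow>
      p \<in> I \<Longrightarrow> q \<in> I \<Longrightarrow> M x p q = M y p q" by blast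
  have "\<sigma> x = \<sigma> y"
    if x: "x \<in> carrier H" and y: "y \<in> carrier H" and g: "g \<in> carrier G" and eq: "\<pi> (x, g) = \<pi> (y, g)" for x y g
  proof -
    define D where "D = equiv_class \<sigma>"
    have D: "D \<in> Orb"
      unfolding D_def Orb_eq
      by (rule image_eqI[of _ _ "\<one>\<^bsub>G\<^esub>"]) (simp_all add: act_one[OF irreducible_repD(1)[OF \<sigma>irr]])
    \<comment> \<open>The block of the kernel that starts at \<open>C\<close> ends in \<open>D\<close>, the class of \<open>\<sigma>\<close>.\<close>
    define C where "C = d (inv\<^bsub>G\<^esub> g) D"
    have C: "C \<in> Orb" and DC: "d g C = D" using g D by (simp_all add: C_def dO dd d1)
    note [simp] = unitary_matD(2-)[OF V(1)[OF g C]]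
    have "m > 0" using irreducible_repD(2)[OF \<sigma>irr] .
    have "\<exists>b<m. V g C $$ (b, 0) \<noteq> 0"
    proof (rule ccontr)
      assume "\<not> ?thesis"
      then have "(\<Sum>i<m. cnj (V g C $$ (i, 0)) * V g C $$ (i, 0)) = 0" by simp
      then show False
        using unitary_matD(4)[OF V(1)[OF g C]] isometry_iff[OF Vc[OF g C]] \<open>m > 0\<close> by simp
    qed
    then obtain b where b: "b < m" "V g C $$ (b, 0) \<noteq> 0" by blast
    have "A x g C = A y g C"
    proof (rule eq_matI)
      fix i j assume "i < dim_row (A y g C)" "j < dim_col (A y g C)"
      then have ij: "i < m" "j < m" using Ac[OF y g C] by auto
      have "M (x, g) (D, i, b) (C, j, 0) = M (y, g) (D, i, b) (C, j, 0)"
        by (rule ker) (use x y g eq D C ij b \<open>m > 0\<close> in \<open>auto simp: I_def\<close>)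
      then show "A x g C $$ (i, j) = A y g C $$ (i, j)" using b(2) DC by (simp add: M_def)
    qed (use Ac[OF x g C] Ac[OF y g C] in auto)
    then have "s D x * V g C * mat_adjoint (V g C) = s D y * V g C * mat_adjoint (V g C)"
      by (simp add: A_def DC)
    then have sD: "s D x = s D y"
      using unitary_rep_carrier[OF s_rep[OF D] x] unitary_rep_carrier[OF s_rep[OF D] y]
      by (simp add: mult_assoc_dim)
    have "(\<sigma>, s D) \<in> unitary_equiv H"
      using equiv_class_eq_iff[OF \<sigma>fd s_fd[OF D]] s(2)[OF D] by (simp add: D_def)
    then obtain n U where U: "irreducible_rep H n \<sigma>" "unitary_mat n U" "intertwiner H n \<sigma> n (s D) U"
      by (rule H.unitary_equivE)
    note [simp] = unitary_matD(2-)[OF U(2)]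
    have "U * \<sigma> x = U * \<sigma> y" using U(3) x y sD by (simp add: intertwiner_def)
    moreover have "mat_adjoint U * (U * \<sigma> z) = \<sigma> z" if "z \<in> carrier H" for z
      using unitary_rep_carrier[OF irreducible_repD(1)[OF U(1)] that]
      by (simp flip: mult_assoc_dim)
    ultimately show ?thesis using x y by metis
  qed
  with \<pi> show ?thesis unfolding fd_reps_def by blast
qed

lemma MAP_semidirect_if:
  assumes G: "MAP G" and H: "separates_points H (finite_orbit_irreps H G \<alpha>)"
  shows "MAP semi"
  unfolding MAP_def separates_points_def
proof (intro ballI impI)
  fix p q assume pq: "p \<in> carrier semi" "q \<in> carrier semi" "p \<noteq> q"
  then obtain h g h' g' where p: "p = (h, g)" "h \<in> carrier H" "g \<in> carrier G"
    and q: "q = (h', g')" "h' \<in> carrier H" "g' \<in> carrier G" by auto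
  show "\<exists>\<pi>\<in>fd_reps semi. \<pi> p \<noteq> \<pi> q"
  proof (cases "g = g'")
    case True
    then have "h \<noteq> h'" using pq(3) p q by simp
    then obtain \<sigma> where "\<sigma> \<in> finite_orbit_irreps H G \<alpha>" "\<sigma> h \<noteq> \<sigma> h'"
      using H p q unfolding separates_points_def by blast
    then show ?thesis using finite_orbit_irrep_separated p q True by blast
  next
    case False
    obtain n \<tau> where \<tau>: "unitary_rep G n \<tau>" "\<tau> g \<noteq> \<tau> g'"
      using MAP_separates[OF G p(3) q(3) False] by blast
    have "unitary_rep semi n (\<lambda>x\<in>carrier semi. \<tau> (snd x))"
      by (rule unitary_rep_compose[OF \<tau>(1)]) (auto simp: hom_def)
    then have "(\<lambda>x\<in>carrier semi. \<tau> (snd x)) \<in> fd_reps semi" unfolding fd_reps_def by blast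
    then show ?thesis by (rule bexI[rotated]) (use \<tau>(2) p q in simp)
  qed
qed

end

theorem proposition4p4:
  fixes H :: "('a, 'm) monoid_scheme" and G :: "('b, 'k) monoid_scheme"
    and \<alpha> :: "'b \<Rightarrow> 'a \<Rightarrow> 'a"
  assumes "group H" and "group G" and "\<alpha> \<in> hom G (AutoGroup H)"
  shows "MAP (semidirect_product H G \<alpha>) \<longleftrightarrow>
    MAP G \<and> separates_points H (finite_orbit_irreps H G \<alpha>)"
proof -
  interpret automorphic_action H G \<alpha>
    using assms by (simp add: automorphic_action_def automorphic_action_axioms_def)
  show ?thesis
    using MAP_semidirect_imp_MAP_G MAP_semidirect_imp_separates MAP_semidirect_if by blast
qed

end
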